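(* Let $\mathcal{C}=(M,g,J)$ be an almost Kähler manifold. Assume either that $\mathcal{J}(\pi)=0$ for all complex lines $\pi\in\mathbb{CP}(TM,J)$ or that $\mathcal{R}(\pi)=0$ for all complex lines $\pi\in\mathbb{CP}(TM,J)$. Then $(M,g)$ is flat.
   Context: An almost Hermitian manifold $(M,g,J)$ is a Riemannian manifold $(M,g)$ with an almost complex structure $J$ ($J^2=-\mathrm{id}$) that is unitary: $g(Jx,Jy)=g(x,y)$. It is almost Kähler if the two-form $\Omega(x,y):=g(Jx,y)$ is closed. Curvature operator: $\mathcal{R}(x,y)=\nabla_x\nabla_y-\nabla_y\nabla_x-\nabla_{[x,y]}$, with $\nabla$ the Levi-Civita connection. Jacobi operator: $\mathcal{J}(x)y=\mathcal{R}(y,x)x$. $\mathbb{CP}(TM,J)$ is the set of all complex lines in tangent spaces of $M$, i.e. real $2$-dimensional subspaces $\pi\subset T_PM$, $P\in M$, with $J\pi=\pi$. For such $\pi$ and any unit vector $x\in\pi$ (so that $\pi=\operatorname{Span}\{x,Jx\}$), $\mathcal{J}(\pi):=\mathcal{J}(x)+\mathcal{J}(Jx)$ and $\mathcal{R}(\pi):=\mathcal{R}(x,Jx)$; these do not depend on the choice of the unit vector $x$. Flat means that the curvature tensor vanishes identically. *)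

theory Defs
  imports "HOL-Analysis.Analysis"
begin

section \<open>Smooth functions on open subsets of a Euclidean space\<close>

text \<open>For open \<open>S\<close>: all iterated directional derivatives up to order \<open>k\<close> exist and are continuous,
  and each one of order less than \<open>k\<close> is totally differentiable.\<close>

fun Ck_on :: "nat \<Rightarrow> ('e::euclidean_space \<Rightarrow> 'b::real_normed_vector) \<Rightarrow> 'e set \<Rightarrow> bool" where
  "Ck_on 0 f S \<longleftrightarrow> continuous_on S f"
| "Ck_on (Suc k) f S \<longleftrightarrow>
     (\<forall>x\<in>S. f differentiable (at x)) \<and>
     (\<forall>v. Ck_on k (\<lambda>x. frechet_derivative f (at x) v) S)"

definition Cinf_on :: "('e::euclidean_space \<Rightarrow> 'b::real_normed_vector) \<Rightarrow> 'e set \<Rightarrow> bool" where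
  "Cinf_on f S \<longleftrightarrow> (\<forall>k. Ck_on k f S)"


section \<open>Smooth manifolds\<close>

text \<open>A chart is a domain together with a coordinate map, which only matters on the domain.\<close>

type_synonym ('a, 'e) chart = "'a set \<times> ('a \<Rightarrow> 'e)"

abbreviation chart_inv :: "('a, 'e) chart \<Rightarrow> 'e \<Rightarrow> 'a" where
  "chart_inv c \<equiv> inv_into (fst c) (snd c)"

record ('a, 'e) mfd =
  mtop :: "'a topology"
  atlas :: "('a, 'e) chart set"

abbreviation points :: "('a, 'e) mfd \<Rightarrow> 'a set" where
  "points M \<equiv> topspace (mtop M)"

definition is_chart :: "'a topology \<Rightarrow> ('a, 'e::euclidean_space) chart \<Rightarrow> bool" where
  "is_chart T c \<longleftrightarrow>
     openin T (fst c) \<and> open (snd c ` fst c) \<and>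
     homeomorphic_map (subtopology T (fst c)) (top_of_set (snd c ` fst c)) (snd c)"

definition smooth_manifold :: "('a, 'e::euclidean_space) mfd \<Rightarrow> bool" where
  "smooth_manifold M \<longleftrightarrow>
     Hausdorff_space (mtop M) \<and> second_countable (mtop M) \<and>
     (\<forall>c\<in>atlas M. is_chart (mtop M) c) \<and>
     (\<Union>c\<in>atlas M. fst c) = points M \<and>
     (\<forall>c\<in>atlas M. \<forall>d\<in>atlas M.
        Cinf_on (snd d \<circ> chart_inv c) (snd c ` (fst c \<inter> fst d)))"


section \<open>Tangent vectors, functions and vector fields\<close>

text \<open>Every point \<open>p\<close> has a preferred chart, and the tangent space at \<open>p\<close> is realised as the model
  space \<open>'e\<close>, a tangent vector being given by its components in the preferred chart at \<open>p\<close>.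
  The components of the same vector in another chart \<open>c\<close> around \<open>p\<close> are obtained by applying the
  differential \<open>chart_diff M c p\<close> of \<open>c\<close>. Since the preferred chart varies
  with the point, smoothness of a vector field \<open>X :: 'a \<Rightarrow> 'e\<close> has to be tested on its components in
  a fixed chart, not on \<open>X\<close> itself.\<close>

definition chart_at :: "('a, 'e) mfd \<Rightarrow> 'a \<Rightarrow> ('a, 'e) chart" where
  "chart_at M p = (SOME c. c \<in> atlas M \<and> p \<in> fst c)"

definition coord_change ::
    "('a, 'e::euclidean_space) chart \<Rightarrow> ('a, 'e) chart \<Rightarrow> 'a \<Rightarrow> 'e \<Rightarrow> 'e" where
  "coord_change c d p = frechet_derivative (snd d \<circ> chart_inv c) (at (snd c p))"

definition chart_diff ::
    "('a, 'e::euclidean_space) mfd \<Rightarrow> ('a, 'e) chart \<Rightarrow> 'a \<Rightarrow> 'e \<Rightarrow> 'e" where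
  "chart_diff M c p = coord_change (chart_at M p) c p"

text \<open>The components in the chart \<open>c\<close> of the vector field \<open>X\<close>, as a function of the coordinates.\<close>

definition field_in_chart ::
    "('a, 'e::euclidean_space) mfd \<Rightarrow> ('a, 'e) chart \<Rightarrow> ('a \<Rightarrow> 'e) \<Rightarrow> 'e \<Rightarrow> 'e" where
  "field_in_chart M c X = (\<lambda>u. chart_diff M c (chart_inv c u) (X (chart_inv c u)))"

definition smooth_fun ::
    "('a, 'e::euclidean_space) mfd \<Rightarrow> 'a set \<Rightarrow> ('a \<Rightarrow> real) \<Rightarrow> bool" where
  "smooth_fun M W f \<longleftrightarrow>
     (\<forall>c\<in>atlas M. Cinf_on (f \<circ> chart_inv c) (snd c ` (fst c \<inter> W)))"

definition smooth_field ::
    "('a, 'e::euclidean_space) mfd \<Rightarrow> 'a set \<Rightarrow> ('a \<Rightarrow> 'e) \<Rightarrow> bool" where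
  "smooth_field M W X \<longleftrightarrow>
     (\<forall>c\<in>atlas M. Cinf_on (field_in_chart M c X) (snd c ` (fst c \<inter> W)))"

text \<open>The derivative \<open>v f\<close> of \<open>f\<close> along the tangent vector \<open>v\<close> at \<open>p\<close>.\<close>

definition dir_deriv ::
    "('a, 'e::euclidean_space) mfd \<Rightarrow> 'a \<Rightarrow> 'e \<Rightarrow> ('a \<Rightarrow> real) \<Rightarrow> real" where
  "dir_deriv M p v f =
     frechet_derivative (f \<circ> chart_inv (chart_at M p)) (at (snd (chart_at M p) p)) v"

text \<open>Computed in the preferred chart at \<open>p\<close>:
  \<open>[X,Y]\<^sup>k = (\<Sum>i. X\<^sup>i \<partial>\<^sub>i Y\<^sup>k - Y\<^sup>i \<partial>\<^sub>i X\<^sup>k)\<close>.\<close>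

definition lie_bracket ::
    "('a, 'e::euclidean_space) mfd \<Rightarrow> ('a \<Rightarrow> 'e) \<Rightarrow> ('a \<Rightarrow> 'e) \<Rightarrow> 'a \<Rightarrow> 'e" where
  "lie_bracket M X Y p =
     (let c = chart_at M p in
        frechet_derivative (field_in_chart M c Y) (at (snd c p)) (X p)
      - frechet_derivative (field_in_chart M c X) (at (snd c p)) (Y p))"


section \<open>Riemannian and almost Kaehler structures\<close>

definition riemannian_metric ::
    "('a, 'e::euclidean_space) mfd \<Rightarrow> ('a \<Rightarrow> 'e \<Rightarrow> 'e \<Rightarrow> real) \<Rightarrow> bool" where
  "riemannian_metric M g \<longleftrightarrow>
     (\<forall>p\<in>points M. bilinear (g p) \<and> (\<forall>x y. g p x y = g p y x) \<and> (\<forall>x. x \<noteq> 0 \<longrightarrow> g p x x > 0)) \<and>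
     (\<forall>W X Y. openin (mtop M) W \<longrightarrow> smooth_field M W X \<longrightarrow> smooth_field M W Y \<longrightarrow>
        smooth_fun M W (\<lambda>p. g p (X p) (Y p)))"

definition almost_complex_structure ::
    "('a, 'e::euclidean_space) mfd \<Rightarrow> ('a \<Rightarrow> 'e \<Rightarrow> 'e) \<Rightarrow> bool" where
  "almost_complex_structure M J \<longleftrightarrow>
     (\<forall>p\<in>points M. linear (J p) \<and> (\<forall>x. J p (J p x) = - x)) \<and>
     (\<forall>W X. openin (mtop M) W \<longrightarrow> smooth_field M W X \<longrightarrow> smooth_field M W (\<lambda>p. J p (X p)))"

definition almost_hermitian_manifold ::
    "('a, 'e::euclidean_space) mfd \<Rightarrow> ('a \<Rightarrow> 'e \<Rightarrow> 'e \<Rightarrow> real) \<Rightarrow> ('a \<Rightarrow> 'e \<Rightarrow> 'e) \<Rightarrow> bool" where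
  "almost_hermitian_manifold M g J \<longleftrightarrow>
     smooth_manifold M \<and> riemannian_metric M g \<and> almost_complex_structure M J \<and>
     (\<forall>p\<in>points M. \<forall>x y. g p (J p x) (J p y) = g p x y)"

text \<open>The invariant formula for \<open>d\<omega>(X,Y,Z)\<close>.\<close>

definition ext_deriv2 ::
    "('a, 'e::euclidean_space) mfd \<Rightarrow> ('a \<Rightarrow> 'e \<Rightarrow> 'e \<Rightarrow> real) \<Rightarrow>
     ('a \<Rightarrow> 'e) \<Rightarrow> ('a \<Rightarrow> 'e) \<Rightarrow> ('a \<Rightarrow> 'e) \<Rightarrow> 'a \<Rightarrow> real" where
  "ext_deriv2 M \<omega> X Y Z p =
     dir_deriv M p (X p) (\<lambda>q. \<omega> q (Y q) (Z q))
   - dir_deriv M p (Y p) (\<lambda>q. \<omega> q (X q) (Z q))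
   + dir_deriv M p (Z p) (\<lambda>q. \<omega> q (X q) (Y q))
   - \<omega> p (lie_bracket M X Y p) (Z p)
   + \<omega> p (lie_bracket M X Z p) (Y p)
   - \<omega> p (lie_bracket M Y Z p) (X p)"

definition closed_2form ::
    "('a, 'e::euclidean_space) mfd \<Rightarrow> ('a \<Rightarrow> 'e \<Rightarrow> 'e \<Rightarrow> real) \<Rightarrow> bool" where
  "closed_2form M \<omega> \<longleftrightarrow>
     (\<forall>W X Y Z. openin (mtop M) W \<longrightarrow>
        smooth_field M W X \<longrightarrow> smooth_field M W Y \<longrightarrow> smooth_field M W Z \<longrightarrow>
        (\<forall>p\<in>W. ext_deriv2 M \<omega> X Y Z p = 0))"

definition kaehler_form ::
    "('a \<Rightarrow> 'e \<Rightarrow> 'e \<Rightarrow> real) \<Rightarrow> ('a \<Rightarrow> 'e \<Rightarrow> 'e) \<Rightarrow> 'a \<Rightarrow> 'e \<Rightarrow> 'e \<Rightarrow> real" where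
  "kaehler_form g J p x y = g p (J p x) y"

definition almost_kaehler_manifold ::
    "('a, 'e::euclidean_space) mfd \<Rightarrow> ('a \<Rightarrow> 'e \<Rightarrow> 'e \<Rightarrow> real) \<Rightarrow> ('a \<Rightarrow> 'e \<Rightarrow> 'e) \<Rightarrow> bool" where
  "almost_kaehler_manifold M g J \<longleftrightarrow>
     almost_hermitian_manifold M g J \<and> closed_2form M (kaehler_form g J)"


section \<open>Levi-Civita connection and curvature\<close>

text \<open>An affine connection is given by the covariant derivatives \<open>nabla p v Y\<close> (i.e. \<open>\<nabla>\<^sub>v Y\<close>) of
  vector fields \<open>Y\<close> that are smooth near \<open>p\<close> along tangent vectors \<open>v\<close> at \<open>p\<close>. Since local fields
  are total functions here, locality (the second clause) is part of the definition; values at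
  fields that are not smooth near \<open>p\<close> are irrelevant.\<close>

definition affine_connection ::
    "('a, 'e::euclidean_space) mfd \<Rightarrow> ('a \<Rightarrow> 'e \<Rightarrow> ('a \<Rightarrow> 'e) \<Rightarrow> 'e) \<Rightarrow> bool" where
  "affine_connection M nabla \<longleftrightarrow>
     (\<forall>W Y. openin (mtop M) W \<longrightarrow> smooth_field M W Y \<longrightarrow>
        (\<forall>p\<in>W. linear (\<lambda>v. nabla p v Y)) \<and>
        (\<forall>Y'. (\<forall>q\<in>W. Y' q = Y q) \<longrightarrow> (\<forall>p\<in>W. \<forall>v. nabla p v Y' = nabla p v Y)) \<and>
        (\<forall>Z. smooth_field M W Z \<longrightarrow>
           (\<forall>p\<in>W. \<forall>v. nabla p v (\<lambda>q. Y q + Z q) = nabla p v Y + nabla p v Z)) \<and>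
        (\<forall>f. smooth_fun M W f \<longrightarrow>
           (\<forall>p\<in>W. \<forall>v. nabla p v (\<lambda>q. f q *\<^sub>R Y q) =
              dir_deriv M p v f *\<^sub>R Y p + f p *\<^sub>R nabla p v Y)) \<and>
        (\<forall>X. smooth_field M W X \<longrightarrow> smooth_field M W (\<lambda>p. nabla p (X p) Y)))"

definition levi_civita_connection ::
    "('a, 'e::euclidean_space) mfd \<Rightarrow> ('a \<Rightarrow> 'e \<Rightarrow> 'e \<Rightarrow> real) \<Rightarrow>
     ('a \<Rightarrow> 'e \<Rightarrow> ('a \<Rightarrow> 'e) \<Rightarrow> 'e) \<Rightarrow> bool" where
  "levi_civita_connection M g nabla \<longleftrightarrow>
     affine_connection M nabla \<and>
     (\<forall>W X Y. openin (mtop M) W \<longrightarrow> smooth_field M W X \<longrightarrow> smooth_field M W Y \<longrightarrow>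
        (\<forall>p\<in>W. nabla p (X p) Y - nabla p (Y p) X = lie_bracket M X Y p)) \<and>
     (\<forall>W Y Z. openin (mtop M) W \<longrightarrow> smooth_field M W Y \<longrightarrow> smooth_field M W Z \<longrightarrow>
        (\<forall>p\<in>W. \<forall>v. dir_deriv M p v (\<lambda>q. g q (Y q) (Z q)) =
           g p (nabla p v Y) (Z p) + g p (Y p) (nabla p v Z)))"

definition field_curvature ::
    "('a, 'e::euclidean_space) mfd \<Rightarrow> ('a \<Rightarrow> 'e \<Rightarrow> ('a \<Rightarrow> 'e) \<Rightarrow> 'e) \<Rightarrow>
     ('a \<Rightarrow> 'e) \<Rightarrow> ('a \<Rightarrow> 'e) \<Rightarrow> ('a \<Rightarrow> 'e) \<Rightarrow> 'a \<Rightarrow> 'e" where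
  "field_curvature M nabla X Y Z p =
     nabla p (X p) (\<lambda>q. nabla q (Y q) Z)
   - nabla p (Y p) (\<lambda>q. nabla q (X q) Z)
   - nabla p (lie_bracket M X Y p) Z"

text \<open>The local field around \<open>p\<close> extending the tangent vector \<open>v\<close> at \<open>p\<close> with constant components
  in the preferred chart at \<open>p\<close>.\<close>

definition coord_field ::
    "('a, 'e::euclidean_space) mfd \<Rightarrow> 'a \<Rightarrow> 'e \<Rightarrow> 'a \<Rightarrow> 'e" where
  "coord_field M p v q = coord_change (chart_at M p) (chart_at M q) q v"

text \<open>The curvature operator at a point. The value \<open>\<R>(x,y)z\<close> does not depend on the local fields
  that extend \<open>x\<close>, \<open>y\<close>, \<open>z\<close>, so coordinate fields are used.\<close>

definition curvature_op ::
    "('a, 'e::euclidean_space) mfd \<Rightarrow> ('a \<Rightarrow> 'e \<Rightarrow> ('a \<Rightarrow> 'e) \<Rightarrow> 'e) \<Rightarrow>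
     'a \<Rightarrow> 'e \<Rightarrow> 'e \<Rightarrow> 'e \<Rightarrow> 'e" where
  "curvature_op M nabla p x y z =
     field_curvature M nabla (coord_field M p x) (coord_field M p y) (coord_field M p z) p"

definition jacobi_op ::
    "('a, 'e::euclidean_space) mfd \<Rightarrow> ('a \<Rightarrow> 'e \<Rightarrow> ('a \<Rightarrow> 'e) \<Rightarrow> 'e) \<Rightarrow>
     'a \<Rightarrow> 'e \<Rightarrow> 'e \<Rightarrow> 'e" where
  "jacobi_op M nabla p x y = curvature_op M nabla p y x x"

definition flat ::
    "('a, 'e::euclidean_space) mfd \<Rightarrow> ('a \<Rightarrow> 'e \<Rightarrow> ('a \<Rightarrow> 'e) \<Rightarrow> 'e) \<Rightarrow> bool" where
  "flat M nabla \<longleftrightarrow> (\<forall>p\<in>points M. \<forall>x y z. curvature_op M nabla p x y z = 0)"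


section \<open>Complex lines\<close>

text \<open>A complex line is recorded together with its base point.\<close>

definition complex_lines ::
    "('a, 'e::euclidean_space) mfd \<Rightarrow> ('a \<Rightarrow> 'e \<Rightarrow> 'e) \<Rightarrow> ('a \<times> 'e set) set" where
  "complex_lines M J =
     {(p, \<pi>). p \<in> points M \<and> subspace \<pi> \<and> dim \<pi> = 2 \<and> J p ` \<pi> = \<pi>}"

text \<open>A unit vector in \<open>\<pi>\<close>; the two operators below do not depend on its choice.\<close>

definition unit_vector_in ::
    "('a \<Rightarrow> 'e \<Rightarrow> 'e \<Rightarrow> real) \<Rightarrow> 'a \<Rightarrow> 'e set \<Rightarrow> 'e" where
  "unit_vector_in g p \<pi> = (SOME x. x \<in> \<pi> \<and> g p x x = 1)"

definition line_jacobi ::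
    "('a, 'e::euclidean_space) mfd \<Rightarrow> ('a \<Rightarrow> 'e \<Rightarrow> 'e \<Rightarrow> real) \<Rightarrow> ('a \<Rightarrow> 'e \<Rightarrow> 'e) \<Rightarrow>
     ('a \<Rightarrow> 'e \<Rightarrow> ('a \<Rightarrow> 'e) \<Rightarrow> 'e) \<Rightarrow> 'a \<Rightarrow> 'e set \<Rightarrow> 'e \<Rightarrow> 'e" where
  "line_jacobi M g J nabla p \<pi> y =
     (let x = unit_vector_in g p \<pi> in
        jacobi_op M nabla p x y + jacobi_op M nabla p (J p x) y)"

definition line_curvature ::
    "('a, 'e::euclidean_space) mfd \<Rightarrow> ('a \<Rightarrow> 'e \<Rightarrow> 'e \<Rightarrow> real) \<Rightarrow> ('a \<Rightarrow> 'e \<Rightarrow> 'e) \<Rightarrow>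
     ('a \<Rightarrow> 'e \<Rightarrow> ('a \<Rightarrow> 'e) \<Rightarrow> 'e) \<Rightarrow> 'a \<Rightarrow> 'e set \<Rightarrow> 'e \<Rightarrow> 'e" where
  "line_curvature M g J nabla p \<pi> z =
     (let x = unit_vector_in g p \<pi> in curvature_op M nabla p x (J p x) z)"

end

theory Submission
  imports Defs
begin

text \<open>Pointwise, either hypothesis forces the curvature tensor to be complex linear:
  \<open>\<R>(Jx,y)z = \<R>(x,Jy)z = \<R>(x,y)Jz\<close>. Such tensors need not vanish, so the closedness of the Kaehler
  form \<open>\<Omega>\<close> has to enter. For \<open>d\<Omega> = 0\<close> both \<open>\<nabla>\<Omega>\<close> and \<open>\<nabla>\<^sup>2\<Omega>\<close> have vanishing cyclic sums, the
  \<open>J\<close>-invariant part of \<open>\<nabla>\<^sup>2\<Omega>\<close> is quadratic in \<open>\<nabla>J\<close> because \<open>J\<^sup>2 = -1\<close>, and the antisymmetric part is the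
  action of the curvature. Combining these as in Gray's curvature identity for almost Kaehler
  manifolds, the curvature terms cancel by complex linearity and there remains
  \<open>|(\<nabla>\<^sub>w J)x - (\<nabla>\<^sub>x J)w|\<^sup>2 = 0\<close>. Hence \<open>g((\<nabla>\<^sub>w J)x, y)\<close> is symmetric in \<open>w, x\<close> and skew in \<open>x, y\<close>,
  so \<open>\<nabla>J = 0\<close> everywhere. Then \<open>\<R>(x,y)\<close> commutes with \<open>J\<close>, which together with
  \<open>g(\<R>(x,y)Jz, Jw) = -g(\<R>(x,y)z, w)\<close> gives \<open>\<R> = 0\<close>.\<close>

section \<open>Calculus of smooth functions\<close>

text \<open>The complex linear tensors in question are the real parts of complex multilinear
  algebraic curvature tensors. Nonzero ones exist from real dimension 4 on, so no algebra at a
  single point can finish the proof and \<Omega> has to be differentiated twice. Gray's computation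
  closes because closedness makes \<nabla>J complex antilinear in the direction as well, so that the
  squared norms in it are unchanged when \<open>J\<close> is applied to either argument. The shape
  of the formal argument comes from tangent vectors being components in a chart that varies with the
  base point: \<open>curvature_op\<close> at a point refers to the preferred chart there, so the
  curvature hypothesis is translated into coordinates only at that point. Closedness, compatibility
  and vanishing torsion are translated on the whole chart domain, and these are the identities that
  get differentiated.\<close>

lemma has_frechet_derivative:
  "f differentiable at x \<Longrightarrow> (f has_derivative frechet_derivative f (at x)) (at x)"
  by (simp add: frechet_derivative_works)

lemma differentiable_transform_within_open:
  assumes "f differentiable at x" "open S" "x \<in> S" "\<And>y. y \<in> S \<Longrightarrow> f y = g y"
  shows "g differentiable at x"
  using assms has_derivative_transform_within_open[of f _ x UNIV S g]
  unfolding differentiable_def by blast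

abbreviation dd :: "('e::euclidean_space \<Rightarrow> 'b::real_normed_vector) \<Rightarrow> 'e \<Rightarrow> 'e \<Rightarrow> 'b" where
  "dd f u v \<equiv> frechet_derivative f (at u) v"

lemma dd_eq: "(f has_derivative f') (at u) \<Longrightarrow> dd f u v = f' v"
  using frechet_derivative_at[of f f' u] by simp

section \<open>Closure properties of k times continuously differentiable maps\<close>

lemma Ck_on_subset: "Ck_on k f S \<Longrightarrow> T \<subseteq> S \<Longrightarrow> Ck_on k f T"
proof (induction k arbitrary: f)
  case 0
  then show ?case by (auto intro: continuous_on_subset)
next
  case (Suc k)
  then show ?case by auto
qed

lemma Ck_on_cong:
  assumes "open S" "Ck_on k f S" "\<And>x. x \<in> S \<Longrightarrow> f x = g x"
  shows "Ck_on k g S"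
  using assms(2,3)
proof (induction k arbitrary: f g)
  case 0
  then show ?case using continuous_on_cong[of S S f g] by simp
next
  case (Suc k)
  have diff: "g differentiable at x" if "x \<in> S" for x
    using Suc.prems that assms(1) by (auto intro: differentiable_transform_within_open)
  moreover have "Ck_on k (\<lambda>x. frechet_derivative g (at x) v) S" for v
  proof (rule Suc.IH)
    show "Ck_on k (\<lambda>x. frechet_derivative f (at x) v) S"
      using Suc.prems by simp
    fix x assume "x \<in> S"
    then show "frechet_derivative f (at x) v = frechet_derivative g (at x) v"
      using frechet_derivative_transform_within_open[OF _ assms(1), of f x g] Suc.prems by simp
  qed
  ultimately show ?case by simp
qed

lemma Ck_on_Suc_imp: "Ck_on (Suc k) f S \<Longrightarrow> Ck_on k f S"
proof (induction k arbitrary: f)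
  case 0
  then show ?case
    by (auto intro!: continuous_at_imp_continuous_on differentiable_imp_continuous_within)
next
  case (Suc k)
  then show ?case using Ck_on.simps(2) by blast
qed

lemma Ck_on_const: "Ck_on k (\<lambda>x. c) S"
  by (induction k arbitrary: c) auto

lemma Ck_on_add:
  assumes "open S" "Ck_on k f S" "Ck_on k g S"
  shows "Ck_on k (\<lambda>x. f x + g x) S"
  using assms(2,3)
proof (induction k arbitrary: f g)
  case 0
  then show ?case by (simp add: continuous_on_add)
next
  case (Suc k)
  have "Ck_on k (\<lambda>x. frechet_derivative (\<lambda>x. f x + g x) (at x) v) S" for v
  proof (rule Ck_on_cong[OF assms(1)])
    show "Ck_on k (\<lambda>x. frechet_derivative f (at x) v + frechet_derivative g (at x) v) S"
      using Suc by simp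
    fix x assume "x \<in> S"
    then have "((\<lambda>x. f x + g x) has_derivative
        (\<lambda>v. frechet_derivative f (at x) v + frechet_derivative g (at x) v)) (at x)"
      using Suc.prems by (auto intro!: has_derivative_add has_frechet_derivative)
    then show "frechet_derivative f (at x) v + frechet_derivative g (at x) v =
        frechet_derivative (\<lambda>x. f x + g x) (at x) v"
      by (simp add: dd_eq)
  qed
  then show ?case using Suc.prems by simp
qed

lemma Ck_on_sum:
  assumes "open S" "\<And>i. i \<in> I \<Longrightarrow> Ck_on k (f i) S"
  shows "Ck_on k (\<lambda>x. \<Sum>i\<in>I. f i x) S"
  using assms(2)
proof (induction I rule: infinite_finite_induct)
  case (insert i I)
  then show ?case using Ck_on_add[OF assms(1), of k "f i" "\<lambda>x. \<Sum>i\<in>I. f i x"] by simp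
qed (simp_all add: Ck_on_const)

lemma Ck_on_bounded_linear:
  assumes "bounded_linear L" "open S" "Ck_on k f S"
  shows "Ck_on k (\<lambda>x. L (f x)) S"
  using assms(3)
proof (induction k arbitrary: f)
  case 0
  then show ?case by (auto intro: bounded_linear.continuous_on[OF assms(1)])
next
  case (Suc k)
  have D: "((\<lambda>x. L (f x)) has_derivative (\<lambda>v. L (frechet_derivative f (at x) v))) (at x)"
    if "x \<in> S" for x
    using Suc.prems that
    by (auto intro!: bounded_linear.has_derivative[OF assms(1)] has_frechet_derivative)
  have "Ck_on k (\<lambda>x. frechet_derivative (\<lambda>x. L (f x)) (at x) v) S" for v
  proof (rule Ck_on_cong[OF assms(2)])
    show "Ck_on k (\<lambda>x. L (frechet_derivative f (at x) v)) S"
      using Suc by simp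
    show "L (frechet_derivative f (at x) v) = frechet_derivative (\<lambda>x. L (f x)) (at x) v"
      if "x \<in> S" for x
      by (simp add: dd_eq[OF D[OF that]])
  qed
  then show ?case using D by (auto simp: differentiable_def)
qed

lemma Ck_on_scaleR:
  assumes "open S" "Ck_on k f S" "Ck_on k g S"
  shows "Ck_on k (\<lambda>x. f x *\<^sub>R g x) S"
  using assms(2,3)
proof (induction k arbitrary: f g)
  case 0
  then show ?case by (simp add: continuous_on_scaleR)
next
  case (Suc k)
  have D: "((\<lambda>x. f x *\<^sub>R g x) has_derivative
      (\<lambda>v. f x *\<^sub>R frechet_derivative g (at x) v + frechet_derivative f (at x) v *\<^sub>R g x)) (at x)"
    if "x \<in> S" for x
    using Suc.prems that
    by (auto intro!: has_derivative_scaleR has_frechet_derivative)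
  have "Ck_on k (\<lambda>x. frechet_derivative (\<lambda>x. f x *\<^sub>R g x) (at x) v) S" for v
  proof (rule Ck_on_cong[OF assms(1)])
    show "Ck_on k (\<lambda>x. f x *\<^sub>R frechet_derivative g (at x) v
        + frechet_derivative f (at x) v *\<^sub>R g x) S"
      using Suc.prems
      by (intro Ck_on_add[OF assms(1)] Suc.IH Ck_on_Suc_imp[OF Suc.prems(1)] Ck_on_Suc_imp[OF Suc.prems(2)]) simp_all
    show "f x *\<^sub>R frechet_derivative g (at x) v + frechet_derivative f (at x) v *\<^sub>R g x
        = frechet_derivative (\<lambda>x. f x *\<^sub>R g x) (at x) v" if "x \<in> S" for x
      by (simp add: dd_eq[OF D[OF that]])
  qed
  then show ?case using D by (auto simp: differentiable_def)
qed

lemma linear_basis_expansion: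
  fixes L :: "'e::euclidean_space \<Rightarrow> 'b::real_vector"
  assumes "linear L"
  shows "L w = (\<Sum>b\<in>Basis. (w \<bullet> b) *\<^sub>R L b)"
proof -
  have "L w = L (\<Sum>b\<in>Basis. (w \<bullet> b) *\<^sub>R b)"
    by (simp add: euclidean_representation)
  also have "\<dots> = (\<Sum>b\<in>Basis. (w \<bullet> b) *\<^sub>R L b)"
    by (simp only: linear_sum[OF assms] linear_scale[OF assms])
  finally show ?thesis .
qed

text \<open>The chain rule differentiates \<open>f\<close> in a direction that moves with the point,
  whereas \<open>Ck_on\<close> speaks of fixed directions. Expanding the moving direction over
  \<open>Basis\<close> gives products to which the induction hypothesis applies.\<close>

lemma Ck_on_compose:
  fixes f :: "'d::euclidean_space \<Rightarrow> 'b::real_normed_vector" and h :: "'c::euclidean_space \<Rightarrow> 'd"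
  assumes "open S" "open T" "Ck_on k f T" "Ck_on k h S" "h ` S \<subseteq> T"
  shows "Ck_on k (\<lambda>x. f (h x)) S"
  using assms(3,4)
proof (induction k arbitrary: f)
  case 0
  then show ?case using assms(5) continuous_on_compose2[of T f S h] by simp
next
  case (Suc k)
  have D: "((\<lambda>x. f (h x)) has_derivative
      (\<lambda>v. frechet_derivative f (at (h x)) (frechet_derivative h (at x) v))) (at x)"
    if "x \<in> S" for x
  proof -
    have "f differentiable at (h x)" "h differentiable at x"
      using Suc.prems that assms(5) by auto
    then show ?thesis
      using has_derivative_compose[OF has_frechet_derivative has_frechet_derivative] by blast
  qed
  have "Ck_on k (\<lambda>x. frechet_derivative (\<lambda>x. f (h x)) (at x) v) S" for v
  proof (rule Ck_on_cong[OF assms(1)])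
    have "Ck_on k (\<lambda>x. (frechet_derivative h (at x) v \<bullet> b) *\<^sub>R frechet_derivative f (at (h x)) b) S"
      for b
    proof (rule Ck_on_scaleR[OF assms(1)])
      show "Ck_on k (\<lambda>x. frechet_derivative h (at x) v \<bullet> b) S"
        using Suc.prems by (intro Ck_on_bounded_linear[OF bounded_linear_inner_left assms(1)]) simp
      show "Ck_on k (\<lambda>x. frechet_derivative f (at (h x)) b) S"
        using Suc.prems Suc.IH[of "\<lambda>y. frechet_derivative f (at y) b"]
          Ck_on_Suc_imp[OF Suc.prems(2)] by simp
    qed
    then show "Ck_on k (\<lambda>x. \<Sum>b\<in>Basis. (frechet_derivative h (at x) v \<bullet> b) *\<^sub>R
        frechet_derivative f (at (h x)) b) S"
      by (rule Ck_on_sum[OF assms(1)])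
    fix x assume "x \<in> S"
    then have "linear (frechet_derivative f (at (h x)))"
      using Suc.prems assms(5) by (auto intro!: linear_frechet_derivative)
    then have "frechet_derivative f (at (h x)) w = (\<Sum>b\<in>Basis. (w \<bullet> b) *\<^sub>R
        frechet_derivative f (at (h x)) b)" for w
      by (rule linear_basis_expansion)
    then show "(\<Sum>b\<in>Basis. (frechet_derivative h (at x) v \<bullet> b) *\<^sub>R
        frechet_derivative f (at (h x)) b) = frechet_derivative (\<lambda>x. f (h x)) (at x) v"
      unfolding dd_eq[OF D[OF \<open>x \<in> S\<close>]] by (rule sym)
  qed
  then show ?case using D by (auto simp: differentiable_def)
qed

lemma Cinf_on_subset: "Cinf_on f S \<Longrightarrow> T \<subseteq> S \<Longrightarrow> Cinf_on f T"
  by (auto simp: Cinf_on_def intro: Ck_on_subset)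

lemma Cinf_on_cong:
  "open S \<Longrightarrow> Cinf_on f S \<Longrightarrow> (\<And>x. x \<in> S \<Longrightarrow> f x = g x) \<Longrightarrow> Cinf_on g S"
  unfolding Cinf_on_def using Ck_on_cong by blast

lemma Cinf_on_compose:
  "open S \<Longrightarrow> open T \<Longrightarrow> Cinf_on f T \<Longrightarrow> Cinf_on h S \<Longrightarrow> h ` S \<subseteq> T \<Longrightarrow> Cinf_on (\<lambda>x. f (h x)) S"
  unfolding Cinf_on_def using Ck_on_compose by blast

lemma Cinf_on_derivative: "Cinf_on f S \<Longrightarrow> Cinf_on (\<lambda>x. frechet_derivative f (at x) v) S"
  unfolding Cinf_on_def using Ck_on.simps(2) by blast

lemma Cinf_on_differentiable: "Cinf_on f S \<Longrightarrow> x \<in> S \<Longrightarrow> f differentiable at x"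
  unfolding Cinf_on_def using Ck_on.simps(2) by blast

section \<open>Symmetry of mixed second derivatives\<close>

lemma second_difference_mean_value:
  fixes f :: "'e::euclidean_space \<Rightarrow> real"
  assumes "Ck_on 2 f S" "r > 0"
    and in_S: "\<And>s t. \<lbrakk>0 \<le> s; s \<le> r; 0 \<le> t; t \<le> r\<rbrakk> \<Longrightarrow> x + s *\<^sub>R v + t *\<^sub>R w \<in> S"
  shows "\<exists>s t. 0 \<le> s \<and> s \<le> r \<and> 0 \<le> t \<and> t \<le> r \<and>
    f (x + r *\<^sub>R v + r *\<^sub>R w) - f (x + r *\<^sub>R v) - f (x + r *\<^sub>R w) + f x =
    r * r * frechet_derivative (\<lambda>y. frechet_derivative f (at y) v) (at (x + s *\<^sub>R v + t *\<^sub>R w)) w"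
proof -
  let ?D = "\<lambda>y. frechet_derivative f (at y)"
  have C: "Ck_on (Suc (Suc 0)) f S"
    using assms(1) by (simp add: numeral_2_eq_2)
  have diff: "f differentiable at y" "(\<lambda>y. ?D y v) differentiable at y" if "y \<in> S" for y
    using C that by auto
  \<comment> \<open>The mean value theorem is used twice: on \<open>h\<close>, the increment along
    \<open>w\<close>, as the base point moves along \<open>v\<close>; then on \<open>k\<close>, the
    derivative along \<open>v\<close>, as the base point moves along \<open>w\<close>.\<close>
  define h where "h s = f (x + s *\<^sub>R v + r *\<^sub>R w) - f (x + s *\<^sub>R v)" for s
  have h': "(h has_derivative (\<lambda>c. ?D (x + s *\<^sub>R v + r *\<^sub>R w) (c *\<^sub>R v) - ?D (x + s *\<^sub>R v) (c *\<^sub>R v)))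
      (at s within {0..r})" if "0 \<le> s" "s \<le> r" for s
  proof -
    have "x + s *\<^sub>R v + r *\<^sub>R w \<in> S" "x + s *\<^sub>R v \<in> S"
      using in_S[of s r] in_S[of s 0] that \<open>r > 0\<close> by auto
    then show ?thesis
      unfolding h_def
      by (intro has_derivative_diff has_derivative_compose[OF _ has_frechet_derivative[OF diff(1)]])
        (auto intro!: derivative_eq_intros)
  qed
  obtain s where s: "s \<in> {0<..<r}"
    "h r - h 0 = ?D (x + s *\<^sub>R v + r *\<^sub>R w) ((r - 0) *\<^sub>R v) - ?D (x + s *\<^sub>R v) ((r - 0) *\<^sub>R v)"
    using mvt_simple[OF \<open>r > 0\<close> h'] by blast
  define k where "k t = ?D (x + s *\<^sub>R v + t *\<^sub>R w) v" for t
  have k': "(k has_derivative (\<lambda>c. frechet_derivative (\<lambda>y. ?D y v)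
      (at (x + s *\<^sub>R v + t *\<^sub>R w)) (c *\<^sub>R w))) (at t within {0..r})" if "0 \<le> t" "t \<le> r" for t
  proof -
    have "x + s *\<^sub>R v + t *\<^sub>R w \<in> S"
      using in_S[of s t] that s by auto
    then show ?thesis
      unfolding k_def
      by (intro has_derivative_compose[OF _ has_frechet_derivative[OF diff(2)]])
        (auto intro!: derivative_eq_intros)
  qed
  obtain t where t: "t \<in> {0<..<r}"
    "k r - k 0 = frechet_derivative (\<lambda>y. ?D y v) (at (x + s *\<^sub>R v + t *\<^sub>R w)) ((r - 0) *\<^sub>R w)"
    using mvt_simple[OF \<open>r > 0\<close> k'] by blast
  have in1: "x + s *\<^sub>R v + r *\<^sub>R w \<in> S" "x + s *\<^sub>R v \<in> S" "x + s *\<^sub>R v + t *\<^sub>R w \<in> S"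
    using in_S[of s r] in_S[of s 0] in_S[of s t] s t by auto
  have "h r - h 0 = r * (k r - k 0)"
    using s(2) in1 diff(1) by (simp add: k_def linear_frechet_derivative linear_scale algebra_simps)
  also have "k r - k 0 = r * frechet_derivative (\<lambda>y. ?D y v) (at (x + s *\<^sub>R v + t *\<^sub>R w)) w"
    using t(2) in1 diff(2) by (simp add: linear_frechet_derivative linear_scale)
  finally have "f (x + r *\<^sub>R v + r *\<^sub>R w) - f (x + r *\<^sub>R v) - f (x + r *\<^sub>R w) + f x
      = r * r * frechet_derivative (\<lambda>y. ?D y v) (at (x + s *\<^sub>R v + t *\<^sub>R w)) w"
    by (simp add: h_def)
  then show ?thesis using s(1) t(1) by (intro exI[of _ s] exI[of _ t]) auto
qed

text \<open>The second difference over a parallelogram does not change when its sides are exchanged,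
  so the two mixed derivatives take a common value at suitable points near \<open>x\<close>.
  Continuity carries this over to \<open>x\<close>.\<close>

proposition second_derivative_symmetric_real:
  fixes f :: "'e::euclidean_space \<Rightarrow> real"
  assumes "open S" "x \<in> S" and C: "Ck_on 2 f S"
  shows "frechet_derivative (\<lambda>y. frechet_derivative f (at y) v) (at x) w =
    frechet_derivative (\<lambda>y. frechet_derivative f (at y) w) (at x) v"
proof -
  define P where "P v w y = frechet_derivative (\<lambda>y. frechet_derivative f (at y) v) (at y) w" for v w y
  have cont: "isCont (P v w) x" for v w
    using C assms(1,2) unfolding P_def by (simp add: numeral_2_eq_2 continuous_on_eq_continuous_at)
  have "\<bar>P v w x - P w v x\<bar> < e" if "e > 0" for e
  proof -
    obtain d1 where d1: "d1 > 0" "\<And>y. dist y x < d1 \<Longrightarrow> dist (P v w y) (P v w x) < e / 2"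
      using cont[of v w] \<open>e > 0\<close> unfolding continuous_at_eps_delta by (meson half_gt_zero)
    obtain d2 where d2: "d2 > 0" "\<And>y. dist y x < d2 \<Longrightarrow> dist (P w v y) (P w v x) < e / 2"
      using cont[of w v] \<open>e > 0\<close> unfolding continuous_at_eps_delta by (meson half_gt_zero)
    obtain d3 where d3: "d3 > 0" "ball x d3 \<subseteq> S"
      using assms(1,2) open_contains_ball by blast
    define d where "d = min d1 (min d2 d3)"
    \<comment> \<open>This keeps the parallelogram with sides \<open>r *\<^sub>R v\<close> and
      \<open>r *\<^sub>R w\<close> within \<open>d / 2\<close> of \<open>x\<close>; the summand 1
      covers \<open>v = w = 0\<close>.\<close>
    define r where "r = d / (2 * (norm v + norm w + 1))"
    have pos: "norm v + norm w + 1 > 0"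
      by (simp add: add_nonneg_pos)
    have "d > 0" using d1 d2 d3 by (simp add: d_def)
    then have "r > 0" using pos by (simp add: r_def)
    have close: "dist (x + s *\<^sub>R a + t *\<^sub>R b) x < d"
      if "0 \<le> s" "s \<le> r" "0 \<le> t" "t \<le> r" "(a, b) = (v, w) \<or> (a, b) = (w, v)" for s t a b
    proof -
      have "dist (x + s *\<^sub>R a + t *\<^sub>R b) x \<le> norm (s *\<^sub>R a) + norm (t *\<^sub>R b)"
        using norm_triangle_ineq[of "s *\<^sub>R a" "t *\<^sub>R b"] by (simp add: dist_norm add.assoc)
      also have "\<dots> \<le> r * norm a + r * norm b"
        using that by (simp add: mult_right_mono add_mono)
      also have "\<dots> \<le> r * (norm v + norm w + 1)"
        using that \<open>r > 0\<close> by (auto simp: algebra_simps)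
      also have "\<dots> = d / 2" using pos by (simp add: r_def field_simps)
      finally show ?thesis using \<open>d > 0\<close> by simp
    qed
    have inS: "x + s *\<^sub>R a + t *\<^sub>R b \<in> S"
      if "0 \<le> s" "s \<le> r" "0 \<le> t" "t \<le> r" "(a, b) = (v, w) \<or> (a, b) = (w, v)" for s t a b
      using close[OF that] d3 by (auto simp: d_def dist_commute subset_eq)
    obtain s t where 1: "0 \<le> s" "s \<le> r" "0 \<le> t" "t \<le> r"
      "f (x + r *\<^sub>R v + r *\<^sub>R w) - f (x + r *\<^sub>R v) - f (x + r *\<^sub>R w) + f x
        = r * r * P v w (x + s *\<^sub>R v + t *\<^sub>R w)"
      using second_difference_mean_value[OF C \<open>r > 0\<close> inS, of v w] unfolding P_def by blast
    obtain s' t' where 2: "0 \<le> s'" "s' \<le> r" "0 \<le> t'" "t' \<le> r"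
      "f (x + r *\<^sub>R w + r *\<^sub>R v) - f (x + r *\<^sub>R w) - f (x + r *\<^sub>R v) + f x
        = r * r * P w v (x + s' *\<^sub>R w + t' *\<^sub>R v)"
      using second_difference_mean_value[OF C \<open>r > 0\<close> inS, of w v] unfolding P_def by blast
    have "x + r *\<^sub>R w + r *\<^sub>R v = x + r *\<^sub>R v + r *\<^sub>R w"
      by simp
    then have "r * r * P v w (x + s *\<^sub>R v + t *\<^sub>R w) = r * r * P w v (x + s' *\<^sub>R w + t' *\<^sub>R v)"
      using 1(5) 2(5) by (simp only:)
    then have eq: "P v w (x + s *\<^sub>R v + t *\<^sub>R w) = P w v (x + s' *\<^sub>R w + t' *\<^sub>R v)"
      using \<open>r > 0\<close> by simp
    have "dist (P v w (x + s *\<^sub>R v + t *\<^sub>R w)) (P v w x) < e / 2"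
      using close[of s t v w] 1 by (intro d1) (auto simp: d_def)
    moreover have "dist (P w v (x + s' *\<^sub>R w + t' *\<^sub>R v)) (P w v x) < e / 2"
      using close[of s' t' w v] 2 by (intro d2) (auto simp: d_def)
    ultimately show ?thesis
      using eq by (simp add: dist_real_def abs_if split: if_splits)
  qed
  from this[of "\<bar>P v w x - P w v x\<bar>"] have "P v w x = P w v x"
    by force
  then show ?thesis by (simp add: P_def)
qed

proposition second_derivative_symmetric:
  fixes f :: "'e::euclidean_space \<Rightarrow> 'b::euclidean_space"
  assumes "open S" "x \<in> S" and C: "Ck_on 2 f S"
  shows "frechet_derivative (\<lambda>y. frechet_derivative f (at y) v) (at x) w =
    frechet_derivative (\<lambda>y. frechet_derivative f (at y) w) (at x) v"
proof (rule euclidean_eqI)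
  fix b :: 'b
  have diff: "f differentiable at y" "(\<lambda>y. frechet_derivative f (at y) v) differentiable at y"
    if "y \<in> S" for y v
    using C that by (auto simp: numeral_2_eq_2)
  have 1: "frechet_derivative (\<lambda>y. f y \<bullet> b) (at y) v = frechet_derivative f (at y) v \<bullet> b"
    if "y \<in> S" for y v
    by (rule dd_eq[OF has_derivative_inner_left[OF has_frechet_derivative[OF diff(1)[OF that]]]])
  have 2: "frechet_derivative (\<lambda>y. frechet_derivative (\<lambda>y. f y \<bullet> b) (at y) v) (at x) w =
    frechet_derivative (\<lambda>y. frechet_derivative f (at y) v) (at x) w \<bullet> b" for v w
  proof -
    have D: "((\<lambda>y. frechet_derivative f (at y) v \<bullet> b) has_derivative
        (\<lambda>w. frechet_derivative (\<lambda>y. frechet_derivative f (at y) v) (at x) w \<bullet> b)) (at x)"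
      using has_derivative_inner_left[OF has_frechet_derivative[OF diff(2)[OF \<open>x \<in> S\<close>]]] .
    then have "((\<lambda>y. frechet_derivative (\<lambda>y. f y \<bullet> b) (at y) v) has_derivative
        (\<lambda>w. frechet_derivative (\<lambda>y. frechet_derivative f (at y) v) (at x) w \<bullet> b)) (at x)"
      by (rule has_derivative_transform_within_open[OF _ assms(1,2)]) (simp add: 1)
    then show ?thesis by (rule dd_eq)
  qed
  have "Ck_on 2 (\<lambda>y. f y \<bullet> b) S"
    using Ck_on_bounded_linear[OF bounded_linear_inner_left assms(1) C] .
  then show "frechet_derivative (\<lambda>y. frechet_derivative f (at y) v) (at x) w \<bullet> b =
      frechet_derivative (\<lambda>y. frechet_derivative f (at y) w) (at x) v \<bullet> b"
    unfolding 2[symmetric] by (rule second_derivative_symmetric_real[OF assms(1,2)])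
qed

section \<open>Complex linear algebraic curvature tensors\<close>

text \<open>Additivity suffices because the arguments only move signs and \<open>J\<close> between
  the slots. It is stated for one slot; the symmetries carry it to the others.\<close>

locale algebraic_curvature =
  fixes R :: "'v::real_vector \<Rightarrow> 'v \<Rightarrow> 'v \<Rightarrow> 'v \<Rightarrow> real" and J :: "'v \<Rightarrow> 'v"
  assumes R_add: "R (x + x') y z w = R x y z w + R x' y z w"
    and R_skew12: "R y x z w = - R x y z w"
    and R_skew34: "R x y w z = - R x y z w"
    and bianchi: "R x y z w + R y z x w + R z x y w = 0"
    and J_J: "J (J x) = - x"
    and J_add: "J (x + y) = J x + J y"
begin

text \<open>Of the four cyclic Bianchi identities, the first plus the fourth minus the second and
  the third leaves \<open>2 * (R x y z w - R z w x y)\<close>.\<close>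

lemma R_pair: "R x y z w = R z w x y"
  using bianchi[of x y z w] bianchi[of y z w x] bianchi[of z w x y] bianchi[of w x y z]
    R_skew34[of y z w x] R_skew34[of z w y x] R_skew34[of x w z y] R_skew34[of z x w y]
    R_skew34[of x y w z] R_skew34[of y w x z] R_skew12[of w y z x] R_skew12[of w x z y]
    R_skew12[of x z w y] R_skew12[of w x y z]
  by linarith

lemma R_add2: "R x (y + y') z w = R x y z w + R x y' z w"
  using R_add R_skew12 by (metis minus_add_distrib)

lemma R_add3: "R x y (z + z') w = R x y z w + R x y z' w"
  using R_add R_pair by metis

lemma R_zero: "R 0 y z w = 0"
  using R_add[of 0 0 y z w] by simp

lemma R_neg: "R (- x) y z w = - R x y z w"
  using R_add[of x "- x" y z w] R_zero by simp

lemma R_neg2: "R x (- y) z w = - R x y z w"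
  using R_neg R_skew12 by metis

lemma R_neg3: "R x y (- z) w = - R x y z w"
  using R_neg R_pair by metis

lemma complex_linear_if_flat_lines:
  assumes flat_lines: "\<And>x z w. R x (J x) z w = 0"
  shows "R (J x) y z w = R x (J y) z w" and "R x y (J z) w = R (J x) y z w"
proof -
  have A: "R (J x) y z w = R x (J y) z w" for x y z w
    using flat_lines[of "x + y" z w] flat_lines[of x z w] flat_lines[of y z w] R_skew12[of "J x" y z w]
    by (simp add: J_add R_add R_add2)
  show "R (J x) y z w = R x (J y) z w" by (rule A)
  have B: "R x y (J z) w = R x y z (J w)" for x y z w
    using A R_pair by metis
  \<comment> \<open>Let \<open>a\<close> be the cyclic sum of \<open>R (J x) y z w\<close> and
    \<open>b\<close> that of \<open>R x y (J z) w\<close>, in \<open>x, y, z\<close>. The Bianchi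
    identity with \<open>J w\<close> gives \<open>b = 0\<close>, the other three add up to
    \<open>2 * a + b = 0\<close>, so \<open>a = 0\<close>; comparing with the instance containing
    \<open>J z\<close> gives the claim.\<close>
  show "R x y (J z) w = R (J x) y z w"
    using bianchi[of "J x" y z w] bianchi[of x "J y" z w] bianchi[of x y "J z" w]
      bianchi[of x y z "J w"] A[of x y z w] A[of y z x w] A[of z x y w]
      B[of x y z w] B[of y z x w] B[of z x y w]
    by linarith
qed

text \<open>The polarised Jacobi operator \<open>F x z y w\<close> determines \<open>R\<close> by
  \<open>F x z y w - F y z x w = 3 R y x z w\<close>, so it suffices to move \<open>J\<close> around in \<open>F\<close>.\<close>

lemma complex_linear_if_jacobi_flat_lines:
  assumes jacobi: "\<And>x y w. R y x x w + R y (J x) (J x) w = 0"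
  shows "R (J x) y z w = R x (J y) z w" and "R x y (J z) w = R (J x) y z w"
proof -
  define F where "F x z y w = R y x z w + R y z x w" for x z y w
  have F_pair: "F x z y w = F y w x z" for x y z w
    using R_pair[of x w y z] R_skew12[of x y w z] R_skew34[of y x w z] unfolding F_def by linarith
  have F_swap: "F x z y w = F z x y w" for x y z w
    unfolding F_def by simp
  have F_cyc: "F x z y w + F z y x w + F y x z w = 0" for x y z w
    using R_skew12[of x y z w] R_skew12[of y z x w] R_skew12[of z x y w] unfolding F_def by linarith
  have R_F: "3 * R y x z w = F x z y w - F y z x w" for x y z w
    using bianchi[of x y z w] R_skew12[of x y z w] R_skew12[of y z x w] R_skew12[of z x y w]
    unfolding F_def by linarith
  have FJJ: "F (J x) (J z) y w = - F x z y w" for x y z w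
    using jacobi[of y "x + z" w] jacobi[of y x w] jacobi[of y z w] unfolding F_def
    by (simp add: J_add R_add2 R_add3)
  have F_neg: "F x (- z) y w = - F x z y w" for x z y w
    unfolding F_def by (simp add: R_neg2 R_neg3)
  have A: "F (J x) z y w = F x (J z) y w" for x y z w
    using FJJ[of x "J z" y w] by (simp add: J_J F_neg)
  have B: "F x z (J y) w = F x z y (J w)" for x y z w
    using A F_pair by metis
  \<comment> \<open>The same elimination as for flat lines, with \<open>F_cyc\<close> in the role of
    the Bianchi identity.\<close>
  have AB: "F (J x) z y w = F x z (J y) w" for x y z w
    using F_cyc[of "J x" z y w] F_cyc[of x "J z" y w] F_cyc[of x z "J y" w] F_cyc[of x z y "J w"]
      A[of x z y w] A[of z y x w] A[of y x z w] B[of x z y w] B[of z y x w] B[of y x z w]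
    by linarith
  show 1: "R (J x) y z w = R x (J y) z w" for x y z w
    using R_F[of "J x" y z w] R_F[of x "J y" z w] AB[of y z x w] A[of x z y w] AB[of x z y w]
    by linarith
  show "R x y (J z) w = R (J x) y z w"
    using R_F[of x y "J z" w] R_F[of "J x" y z w] AB[of y z x w] A[of y z x w] A[of x z y w]
    by linarith
qed

end

section \<open>The covariant derivative of the Kaehler form at a point\<close>

text \<open>\<open>N w x\<close> stands for \<open>(\<nabla>\<^sub>w J) x\<close>, \<open>S w x y z\<close> for \<open>(\<nabla>\<^sup>2 \<Omega>)(w, x; y, z)\<close> and \<open>K w x\<close> for the action of the
  curvature operator \<open>\<R>(w, x)\<close> on \<open>\<Omega>\<close>.\<close>

locale second_derivative_kaehler_form =
  fixes G :: "'v::real_vector \<Rightarrow> 'v \<Rightarrow> real" and J :: "'v \<Rightarrow> 'v" and N :: "'v \<Rightarrow> 'v \<Rightarrow> 'v"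
    and S K :: "'v \<Rightarrow> 'v \<Rightarrow> 'v \<Rightarrow> 'v \<Rightarrow> real"
  assumes G_sym: "G x y = G y x" and G_add: "G (x + x') y = G x y + G x' y"
    and G_pos: "x \<noteq> 0 \<Longrightarrow> G x x > 0"
    and J_J: "J (J x) = - x" and J_isometry: "G (J x) (J y) = G x y"
    and N_skew: "G (N x y) z = - G y (N x z)"
    and N_J: "N x (J y) = - J (N x y)"
    and N_cyc: "G (N x y) z + G (N y z) x + G (N z x) y = 0"
    and S_neg2: "S w (- x) y z = - S w x y z"
    and S_neg1: "S (- w) x y z = - S w x y z"
    and S_neg3: "S w x (- y) z = - S w x y z"
    and S_skew: "S w x z y = - S w x y z"
    and S_cyc: "S w x y z + S w y z x + S w z x y = 0"
    and S_JJ: "S w x (J y) (J z) + S w x y z = - G (N x (N w y)) (J z) - G (N x (J y)) (N w z)"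
    and ricci: "S w x y z - S x w y z = K w x y z"
    and K_exchange: "K x w x (J w) = K x (J w) x w"
begin

lemma G_add2: "G x (y + y') = G x y + G x y'"
  using G_add G_sym by metis

lemma G_zero: "G 0 y = 0"
  using G_add[of 0 0 y] by simp

lemma G_neg: "G (- x) y = - G x y"
  using G_add[of x "- x" y] G_zero by simp

lemma G_neg2: "G x (- y) = - G x y"
  using G_neg G_sym by metis

lemma G_J: "G (J x) y = - G x (J y)"
  using J_isometry[of x "J y"] by (simp add: J_J G_neg2)

lemma J_neg: "J (- x) = - J x"
  using J_J[of x] J_J[of "J x"] by simp

lemma N_neg: "N x (- y) = - N x y"
  using N_J[of x "J y"] N_J[of x y] by (simp add: J_J J_neg)

lemma G_eqI:
  assumes "\<And>z. G x z = G y z"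
  shows "x = y"
proof (rule ccontr)
  assume "x \<noteq> y"
  then have "G (x + - y) (x + - y) > 0"
    using G_pos[of "x + - y"] by simp
  then show False
    using assms[of "x + - y"] G_add[of x "- y" "x + - y"] G_neg[of y "x + - y"] by simp
qed

text \<open>The quasi-Kaehler identity, a consequence of closedness: \<open>T\<close>, that is
  \<nabla>\<Omega>, changes sign under \<open>J\<close> in its last two slots, and the cyclic
  identity transports this behaviour to the first slot.\<close>

lemma N_Jx: "N (J x) y = - J (N x y)"
proof (rule G_eqI)
  fix z
  define T where "T x y z = G (N x y) z" for x y z
  have T_skew: "T x z y = - T x y z" for x y z
    unfolding T_def using N_skew G_sym by metis
  have T_JJ: "T x (J y) (J z) = - T x y z" for x y z
    unfolding T_def by (simp add: N_J G_neg J_isometry)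
  have T_neg: "T x (- y) z = - T x y z" for x y z
    unfolding T_def using N_skew[of x "- y" z] N_skew[of x y z] by (simp add: G_neg)
  have T_move: "T x y (J z) = T x (J y) z" for x y z
    using T_JJ[of x y "J z"] T_neg[of x z "J y"] T_skew[of x z "J y"] T_skew[of x "- z" "J y"]
    by (simp add: J_J)
  have T_cyc: "T x y z + T y z x + T z x y = 0" for x y z
    unfolding T_def by (rule N_cyc)
  have C: "T (J x) (J y) z = - T x y z" for x y z
  proof -
    \<comment> \<open>The cyclic rotations give three linear equations for the three unknowns
      \<open>T (J x) (J y) z\<close>, \<open>T (J y) (J z) x\<close>,
      \<open>T (J z) (J x) y\<close>.\<close>
    have "T (J x) (J y) z + T (J y) (J z) x - T z x y = 0" for x y z
      using T_cyc[of "J x" "J y" z] T_JJ[of z x y] T_move[of "J y" z x] by linarith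
    from this[of x y z] this[of y z x] this[of z x y] show ?thesis
      using T_cyc[of x y z] by linarith
  qed
  show "G (N (J x) y) z = G (- J (N x y)) z"
    using C[of x "J y" z] by (simp add: T_def J_J N_neg N_J G_neg)
qed

text \<open>Skewness of \<open>N\<close> brings the quadratic terms into a form that is symmetric in
  \<open>w\<close> and \<open>x\<close>.\<close>

lemma S_JJ_sym:
  "S w x (J y) (J z) + S w x y z = - G (N w y) (J (N x z)) - G (N x y) (J (N w z))"
  using S_JJ[of w x y z] N_skew[of x "N w y" "J z"]
  by (simp add: N_J G_neg G_neg2 G_J)

lemma S_neg4: "S w x y (- z) = - S w x y z"
  using S_neg3 S_skew by metis

text \<open>Summing this identity over \<open>(w, x)\<close>, \<open>(J w, x)\<close>, \<open>(w, J x)\<close>, \<open>(J w, J x)\<close> turns the right-hand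
  side into \<open>J\<close>-invariant parts of \<open>S\<close>, which are quadratic in \<open>N\<close>.\<close>

lemma norm_N_eq_S:
  "G (N w x) (N w x) + G (N x w) (N x w) =
    S w (J x) w x - S w x w (J x) - S w x x (J w) + S (J w) x x w"
proof -
  \<comment> \<open>With \<open>y = x\<close> and \<open>z = J x\<close> the two terms on the left
    of \<open>S_JJ_sym\<close> coincide, and so do the two on the right.\<close>
  have diag: "S w w x (J x) = - G (N w x) (N w x)" for w x
    using S_JJ_sym[of w w x "J x"] S_skew[of w w "J x" x]
    by (simp add: J_J J_neg N_J G_neg2 S_neg4)
  show ?thesis
    \<comment> \<open>The cyclic identity moves the repeated direction out of the diagonal entries.
      The two Ricci identities then produce \<open>K x w x (J w)\<close> and
      \<open>K x (J w) x w\<close>, which cancel by \<open>K_exchange\<close>.\<close>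
    using diag[of w x] diag[of x w] S_cyc[of w w x "J x"] S_cyc[of x x w "J w"]
      S_skew[of w x "J x" w] S_skew[of x w "J w" x] ricci[of x w x "J w"]
      ricci[of x "J w" x w] K_exchange[of x w] by linarith
qed

lemma N_sym: "N w x = N x w"
proof -
  define E where "E w x = G (N w x) (N w x) + G (N x w) (N x w)" for w x
  have E: "E w x = S w (J x) w x - S w x w (J x) - S w x x (J w) + S (J w) x x w" for w x
    unfolding E_def by (rule norm_N_eq_S)
  have E_J: "E (J w) x = E w x" "E w (J x) = E w x" for w x
    by (simp_all add: E_def N_Jx N_J G_neg G_neg2 J_isometry)
  note simps = N_Jx N_J J_J G_neg G_neg2 J_isometry G_J S_neg1 S_neg2 S_neg3 S_neg4
  \<comment> \<open>Averaging costs nothing on the left: by \<open>N_Jx\<close>, \<open>N_J\<close>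
    and isometry, \<open>E\<close> is unchanged when \<open>J\<close> is applied to either
    argument.\<close>
  have "4 * E w x = E w x + E (J w) x + E w (J x) + E (J w) (J x)"
    by (simp add: E_J)
  also have "\<dots> = 8 * G (N w x) (N x w)"
    unfolding E
    using S_JJ_sym[of w x w "J x"] S_JJ_sym[of "J w" x w x] S_JJ_sym[of w "J x" w x]
      S_JJ_sym[of "J w" "J x" w "J x"] S_skew[of w x x "J w"] S_skew[of "J w" x x w]
      S_skew[of w "J x" "J x" "J w"] S_skew[of "J w" "J x" "J x" w] G_sym[of "N x w" "N w x"]
    by (simp add: simps J_neg)
  finally have "E w x - 2 * G (N w x) (N x w) = 0"
    by simp
  then have "G (N w x + - N x w) (N w x + - N x w) = 0"
    using G_sym[of "N w x" "N x w"] unfolding E_def G_add G_add2 G_neg G_neg2 by linarith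
  then have "N w x + - N x w = 0"
    using G_pos by (metis less_irrefl)
  then show ?thesis by simp
qed

lemma N_eq_0: "N x y = 0"
proof (rule G_eqI)
  fix z
  have skew: "G (N x y) z = - G (N x z) y" for x y z
    using N_skew G_sym by metis
  have sym: "G (N x y) z = G (N y x) z" for x y z
    using N_sym by metis
  \<comment> \<open>Alternating skewness and symmetry six times returns to the starting term after
    three sign changes.\<close>
  show "G (N x y) z = G 0 z"
    using skew[of x y z] sym[of x z y] skew[of z x y] sym[of z y x] skew[of y z x] sym[of y x z]
    by (simp add: G_zero)
qed

end

section \<open>Families of linear and bilinear maps\<close>

lemma dd_cong:
  assumes "open U" "u \<in> U" "\<And>y. y \<in> U \<Longrightarrow> f y = h y" "f differentiable at u"
  shows "dd f u v = dd h u v"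
  using frechet_derivative_transform_within_open[OF assms(4,1,2,3)] by simp

lemma dd_minus: "f differentiable at u \<Longrightarrow> dd (\<lambda>y. - f y) u v = - dd f u v"
  by (rule dd_eq[of _ "\<lambda>v. - dd f u v"]) (intro has_derivative_minus has_frechet_derivative)

lemma linear_dd: "f differentiable at u \<Longrightarrow> linear (dd f u)"
  by (rule linear_frechet_derivative)

context
  fixes U :: "'e::euclidean_space set" and u :: 'e
  assumes U: "open U" "u \<in> U"
begin

lemma linear_dd_family:
  fixes L :: "'e \<Rightarrow> 'c::real_vector \<Rightarrow> 'b::real_normed_vector"
  assumes lin: "\<And>y. y \<in> U \<Longrightarrow> linear (L y)"
    and diff: "\<And>x. (\<lambda>y. L y x) differentiable at u"
  shows "linear (\<lambda>x. dd (\<lambda>y. L y x) u v)"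
proof (rule linearI)
  fix a b
  have "((\<lambda>y. L y a + L y b) has_derivative (\<lambda>v. dd (\<lambda>y. L y a) u v + dd (\<lambda>y. L y b) u v)) (at u)"
    by (intro has_derivative_add has_frechet_derivative diff)
  then have "((\<lambda>y. L y (a + b)) has_derivative (\<lambda>v. dd (\<lambda>y. L y a) u v + dd (\<lambda>y. L y b) u v)) (at u)"
    by (rule has_derivative_transform_within_open[OF _ U]) (simp add: linear_add lin)
  then show "dd (\<lambda>y. L y (a + b)) u v = dd (\<lambda>y. L y a) u v + dd (\<lambda>y. L y b) u v"
    by (rule dd_eq)
next
  fix r a
  have "((\<lambda>y. r *\<^sub>R L y a) has_derivative (\<lambda>v. r *\<^sub>R dd (\<lambda>y. L y a) u v)) (at u)"
    by (intro has_derivative_scaleR_right has_frechet_derivative diff)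
  then have "((\<lambda>y. L y (r *\<^sub>R a)) has_derivative (\<lambda>v. r *\<^sub>R dd (\<lambda>y. L y a) u v)) (at u)"
    by (rule has_derivative_transform_within_open[OF _ U]) (simp add: linear_scale lin)
  then show "dd (\<lambda>y. L y (r *\<^sub>R a)) u v = r *\<^sub>R dd (\<lambda>y. L y a) u v"
    by (rule dd_eq)
qed

text \<open>A product rule in which the family is differentiable only argument by argument; over
  \<open>Basis\<close> it becomes the rule for a finite sum of scalar multiples.\<close>

lemma has_derivative_linear_family:
  fixes L :: "'e \<Rightarrow> 'c::euclidean_space \<Rightarrow> 'b::real_normed_vector"
  assumes lin: "\<And>y. y \<in> U \<Longrightarrow> linear (L y)"
    and diff: "\<And>x. (\<lambda>y. L y x) differentiable at u"
    and f: "(f has_derivative f') (at u)"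
  shows "((\<lambda>y. L y (f y)) has_derivative (\<lambda>v. dd (\<lambda>y. L y (f u)) u v + L u (f' v))) (at u)"
proof -
  have "((\<lambda>y. \<Sum>b\<in>Basis. (f y \<bullet> b) *\<^sub>R L y b) has_derivative
      (\<lambda>v. \<Sum>b\<in>Basis. (f u \<bullet> b) *\<^sub>R dd (\<lambda>y. L y b) u v + (f' v \<bullet> b) *\<^sub>R L u b)) (at u)"
    by (intro has_derivative_sum has_derivative_scaleR has_derivative_inner_left f
        has_frechet_derivative diff)
  moreover have "(\<Sum>b\<in>Basis. (f u \<bullet> b) *\<^sub>R dd (\<lambda>y. L y b) u v + (f' v \<bullet> b) *\<^sub>R L u b) =
      dd (\<lambda>y. L y (f u)) u v + L u (f' v)" for v
    using linear_basis_expansion[OF linear_dd_family[of L v, OF lin diff], of "f u"]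
      linear_basis_expansion[OF lin[OF U(2)], of "f' v"] by (simp add: sum.distrib)
  ultimately have "((\<lambda>y. \<Sum>b\<in>Basis. (f y \<bullet> b) *\<^sub>R L y b) has_derivative
      (\<lambda>v. dd (\<lambda>y. L y (f u)) u v + L u (f' v))) (at u)"
    by simp
  then show ?thesis
    by (rule has_derivative_transform_within_open[OF _ U])
      (rule linear_basis_expansion[OF lin, symmetric])
qed

lemma has_derivative_bilinear_family:
  fixes B :: "'e \<Rightarrow> 'c::euclidean_space \<Rightarrow> 'd::euclidean_space \<Rightarrow> 'b::real_normed_vector"
  assumes bil: "\<And>y. y \<in> U \<Longrightarrow> bilinear (B y)"
    and diff: "\<And>x x'. (\<lambda>y. B y x x') differentiable at u"
    and f: "(f has_derivative f') (at u)" and h: "(h has_derivative h') (at u)"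
  shows "((\<lambda>y. B y (f y) (h y)) has_derivative
    (\<lambda>v. dd (\<lambda>y. B y (f u) (h u)) u v + B u (f u) (h' v) + B u (f' v) (h u))) (at u)"
proof -
  have lin1: "linear (\<lambda>x. B y x x')" and lin2: "linear (B y x)" if "y \<in> U" for y x x'
    using bil[OF that] by (auto simp: bilinear_def)
  have D: "((\<lambda>y. B y x (h y)) has_derivative (\<lambda>v. dd (\<lambda>y. B y x (h u)) u v + B u x (h' v))) (at u)" for x
    by (rule has_derivative_linear_family[OF lin2 diff h])
  then have "(\<lambda>y. B y x (h y)) differentiable at u" for x
    by (auto simp: differentiable_def)
  from has_derivative_linear_family[of "\<lambda>y x. B y x (h y)", OF lin1 this f] show ?thesis
    by (simp add: dd_eq[OF D])
qed

end

section \<open>A torsion-free connection in a chart\<close>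

locale connection_chart =
  fixes U :: "'e::euclidean_space set" and Gam :: "'e \<Rightarrow> 'e \<Rightarrow> 'e \<Rightarrow> 'e"
  assumes open_U: "open U"
    and Gam_linear1: "u \<in> U \<Longrightarrow> linear (\<lambda>x. Gam u x y)"
    and Gam_sym: "u \<in> U \<Longrightarrow> Gam u x y = Gam u y x"
    and Gam_diff: "u \<in> U \<Longrightarrow> (\<lambda>u. Gam u x y) differentiable at u"
begin

lemma Gam_linear2: "u \<in> U \<Longrightarrow> linear (\<lambda>y. Gam u x y)"
  using Gam_linear1[of u x] Gam_sym[of u] by simp

text \<open>The curvature on constant fields, whose brackets vanish.\<close>

definition Riem :: "'e \<Rightarrow> 'e \<Rightarrow> 'e \<Rightarrow> 'e \<Rightarrow> 'e" where
  "Riem u x y z = dd (\<lambda>u. Gam u y z) u x - dd (\<lambda>u. Gam u x z) u y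
     + Gam u x (Gam u y z) - Gam u y (Gam u x z)"

definition C2_form :: "('e \<Rightarrow> 'e \<Rightarrow> 'e \<Rightarrow> real) \<Rightarrow> bool" where
  "C2_form B \<longleftrightarrow> (\<forall>u\<in>U. bilinear (B u)) \<and> (\<forall>x y. Ck_on 2 (\<lambda>u. B u x y) U)"

text \<open>\<open>Gam u x y\<close> are the coordinates of \<open>\<nabla>\<^sub>x y\<close> for constant fields (the Christoffel symbols);
  \<open>nab B u x y z\<close> stands for \<open>(\<nabla>\<^sub>x B)(y, z)\<close> and \<open>nab2 B u w x y z\<close> for \<open>(\<nabla>\<^sup>2 B)(w, x; y, z)\<close>, with \<open>w\<close>
  the direction of the outer derivative.\<close>

definition nab :: "('e \<Rightarrow> 'e \<Rightarrow> 'e \<Rightarrow> real) \<Rightarrow> 'e \<Rightarrow> 'e \<Rightarrow> 'e \<Rightarrow> 'e \<Rightarrow> real" where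
  "nab B u x y z = dd (\<lambda>u. B u y z) u x - B u (Gam u x y) z - B u y (Gam u x z)"

definition nab2 :: "('e \<Rightarrow> 'e \<Rightarrow> 'e \<Rightarrow> real) \<Rightarrow> 'e \<Rightarrow> 'e \<Rightarrow> 'e \<Rightarrow> 'e \<Rightarrow> 'e \<Rightarrow> real" where
  "nab2 B u w x y z = dd (\<lambda>u. nab B u x y z) u w - nab B u (Gam u w x) y z
     - nab B u x (Gam u w y) z - nab B u x y (Gam u w z)"

lemma Riem_skew: "Riem u y x z = - Riem u x y z"
  by (simp add: Riem_def)

lemma Riem_bianchi:
  assumes "u \<in> U"
  shows "Riem u x y z + Riem u y z x + Riem u z x y = 0"
proof -
  have dd_sym: "dd (\<lambda>u. Gam u x y) u z = dd (\<lambda>u. Gam u y x) u z" for x y z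
    by (rule dd_cong[OF open_U assms Gam_sym Gam_diff[OF assms]])
  show ?thesis
    using Gam_sym[OF assms, of x y] Gam_sym[OF assms, of x z] Gam_sym[OF assms, of y z]
      dd_sym[of x y z] dd_sym[of x z y] dd_sym[of y z x] by (simp add: Riem_def)
qed

lemma Riem_linear1:
  assumes "u \<in> U"
  shows "linear (\<lambda>x. Riem u x y z)"
proof -
  have "linear (\<lambda>x. Gam u y (Gam u x z))"
    using linear_compose[OF Gam_linear1[OF assms, of z] Gam_linear2[OF assms, of y]]
    unfolding o_def .
  then show ?thesis
    unfolding Riem_def
    by (intro linear_compose_add linear_compose_sub linear_dd Gam_diff[OF assms] Gam_linear1[OF assms]
        linear_dd_family[where L = "\<lambda>u x. Gam u x z", OF open_U assms Gam_linear1 Gam_diff[OF assms]])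
qed

lemma Riem_linear2:
  assumes "u \<in> U"
  shows "linear (\<lambda>y. Riem u x y z)"
  unfolding Riem_skew[of u x _ z] by (intro linear_compose_neg Riem_linear1[OF assms])

lemma Riem_linear3:
  assumes "u \<in> U"
  shows "linear (\<lambda>z. Riem u x y z)"
proof -
  have "linear (\<lambda>z. Gam u x (Gam u y z))" for x y
    using linear_compose[OF Gam_linear2[OF assms, of y] Gam_linear2[OF assms, of x]]
    unfolding o_def .
  then show ?thesis
    unfolding Riem_def
    by (intro linear_compose_add linear_compose_sub
        linear_dd_family[where L = "\<lambda>u x. Gam u _ x", OF open_U assms Gam_linear2 Gam_diff[OF assms]])
qed

lemma nab_skew:
  assumes "u \<in> U" "\<And>u x y. u \<in> U \<Longrightarrow> B u y x = - B u x y" "C2_form B"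
  shows "nab B u x z y = - nab B u x y z"
proof -
  have diff: "(\<lambda>u. B u y z) differentiable at u" for y z
    using assms(1,3) by (simp add: C2_form_def numeral_2_eq_2)
  have "dd (\<lambda>u. B u z y) u x = dd (\<lambda>u. - B u y z) u x"
    by (rule dd_cong[OF open_U assms(1) assms(2) diff])
  then have "dd (\<lambda>u. B u z y) u x = - dd (\<lambda>u. B u y z) u x"
    unfolding dd_minus[OF diff] .
  then show ?thesis
    using assms(2)[OF assms(1), of "Gam u x y" z] assms(2)[OF assms(1), of "Gam u x z" y]
    unfolding nab_def by linarith
qed

context
  fixes B
  assumes B: "C2_form B"
begin

lemma C2_form_diff: "u \<in> U \<Longrightarrow> (\<lambda>u. B u x y) differentiable at u"
  using B by (simp add: C2_form_def numeral_2_eq_2)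

lemma C2_form_bilinear: "u \<in> U \<Longrightarrow> bilinear (B u)"
  using B by (simp add: C2_form_def)

lemma C2_form_linear1: "u \<in> U \<Longrightarrow> linear (\<lambda>x. B u x y)"
  using C2_form_bilinear by (simp add: bilinear_def)

lemma C2_form_linear2: "u \<in> U \<Longrightarrow> linear (B u x)"
  using C2_form_bilinear by (simp add: bilinear_def)

lemma nab_has_derivative:
  assumes "u \<in> U"
  shows "((\<lambda>u. nab B u x y z) has_derivative (\<lambda>w. dd (\<lambda>u. dd (\<lambda>u. B u y z) u x) u w
    - (dd (\<lambda>v. B v (Gam u x y) z) u w + B u (dd (\<lambda>u. Gam u x y) u w) z)
    - (dd (\<lambda>v. B v y (Gam u x z)) u w + B u y (dd (\<lambda>u. Gam u x z) u w)))) (at u)"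
  unfolding nab_def
proof (intro has_derivative_diff)
  show "((\<lambda>u. dd (\<lambda>u. B u y z) u x) has_derivative dd (\<lambda>u. dd (\<lambda>u. B u y z) u x) u) (at u)"
    using B assms by (intro has_frechet_derivative) (simp add: C2_form_def numeral_2_eq_2)
  show "((\<lambda>v. B v (Gam v x y) z) has_derivative
      (\<lambda>w. dd (\<lambda>v. B v (Gam u x y) z) u w + B u (dd (\<lambda>u. Gam u x y) u w) z)) (at u)"
    by (rule has_derivative_linear_family[where L = "\<lambda>v a. B v a z", OF open_U assms])
      (use C2_form_linear1 C2_form_diff assms has_frechet_derivative[OF Gam_diff] in auto)
  show "((\<lambda>v. B v y (Gam v x z)) has_derivative
      (\<lambda>w. dd (\<lambda>v. B v y (Gam u x z)) u w + B u y (dd (\<lambda>u. Gam u x z) u w))) (at u)"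
    by (rule has_derivative_linear_family[where L = "\<lambda>v a. B v y a", OF open_U assms])
      (use C2_form_linear2 C2_form_diff assms has_frechet_derivative[OF Gam_diff] in auto)
qed

lemma nab_diff: "u \<in> U \<Longrightarrow> (\<lambda>u. nab B u x y z) differentiable at u"
  using nab_has_derivative unfolding differentiable_def by blast

text \<open>Second coordinate derivatives of \<open>B\<close> cancel by their symmetry, and the
  corrections in the direction slot by that of \<open>Gam\<close>. The surviving derivatives and
  products of \<open>Gam\<close> assemble to \<open>Riem\<close>.\<close>

lemma ricci_identity:
  assumes "u \<in> U"
  shows "nab2 B u w x y z - nab2 B u x w y z = - B u (Riem u w x y) z - B u y (Riem u w x z)"
proof -
  have sym: "dd (\<lambda>u. dd (\<lambda>u. B u y z) u x) u w = dd (\<lambda>u. dd (\<lambda>u. B u y z) u w) u x"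
    using second_derivative_symmetric_real[OF open_U assms] B by (simp add: C2_form_def)
  note bil = C2_form_bilinear[OF assms]
  show ?thesis
    unfolding nab2_def dd_eq[OF nab_has_derivative[OF assms]] Gam_sym[OF assms, of x w] sym
    by (simp add: nab_def Riem_def bilinear_ladd[OF bil] bilinear_lsub[OF bil]
        bilinear_radd[OF bil] bilinear_rsub[OF bil])
qed

lemma nab_linear1:
  assumes "u \<in> U"
  shows "linear (\<lambda>x. nab B u x y z)"
  unfolding nab_def
  by (intro linear_compose_sub linear_dd C2_form_diff[OF assms]
      linear_compose[OF Gam_linear1[OF assms] C2_form_linear1[OF assms], unfolded o_def]
      linear_compose[OF Gam_linear1[OF assms] C2_form_linear2[OF assms], unfolded o_def])

lemma nab_linear2:
  assumes "u \<in> U"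
  shows "linear (\<lambda>y. nab B u x y z)"
  unfolding nab_def
  by (intro linear_compose_sub C2_form_linear1[OF assms]
      linear_dd_family[where L = "\<lambda>v a. B v a z", OF open_U assms C2_form_linear1 C2_form_diff[OF assms]]
      linear_compose[OF Gam_linear2[OF assms] C2_form_linear1[OF assms], unfolded o_def])

lemma nab_linear3:
  assumes "u \<in> U"
  shows "linear (\<lambda>z. nab B u x y z)"
  unfolding nab_def
  by (intro linear_compose_sub C2_form_linear2[OF assms]
      linear_dd_family[where L = "\<lambda>v a. B v y a", OF open_U assms C2_form_linear2 C2_form_diff[OF assms]]
      linear_compose[OF Gam_linear2[OF assms] C2_form_linear2[OF assms], unfolded o_def])

lemma nab2_neg:
  assumes "u \<in> U"
  shows "nab2 B u (- w) x y z = - nab2 B u w x y z"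
    and "nab2 B u w (- x) y z = - nab2 B u w x y z"
    and "nab2 B u w x (- y) z = - nab2 B u w x y z"
proof -
  note nab_neg = linear_neg[OF nab_linear1[OF assms]] linear_neg[OF nab_linear2[OF assms]]
    linear_neg[OF nab_linear3[OF assms]]
  note Gam_neg = linear_neg[OF Gam_linear1[OF assms]] linear_neg[OF Gam_linear2[OF assms]]
  note diff = nab_diff[OF assms]
  show "nab2 B u (- w) x y z = - nab2 B u w x y z"
    by (simp add: nab2_def linear_neg[OF linear_dd[OF diff]] Gam_neg nab_neg)
  have "dd (\<lambda>u. nab B u (- x) y z) u w = - dd (\<lambda>u. nab B u x y z) u w"
    by (rule linear_neg[OF linear_dd_family[where L = "\<lambda>u x. nab B u x y z", OF open_U assms nab_linear1 diff]])
  then show "nab2 B u w (- x) y z = - nab2 B u w x y z"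
    by (simp add: nab2_def Gam_neg nab_neg)
  have "dd (\<lambda>u. nab B u x (- y) z) u w = - dd (\<lambda>u. nab B u x y z) u w"
    by (rule linear_neg[OF linear_dd_family[where L = "\<lambda>u y. nab B u x y z", OF open_U assms nab_linear2 diff]])
  then show "nab2 B u w x (- y) z = - nab2 B u w x y z"
    by (simp add: nab2_def Gam_neg nab_neg)
qed

lemma nab2_eq_0:
  assumes "u \<in> U" "\<And>u x y z. u \<in> U \<Longrightarrow> nab B u x y z = 0"
  shows "nab2 B u w x y z = 0"
  using dd_cong[OF open_U assms(1), of "\<lambda>u. nab B u x y z" "\<lambda>u. 0"] nab_diff[OF assms(1)] assms
  by (simp add: nab2_def)

text \<open>An identity valid on all of \<open>U\<close> may be differentiated, and the corrections
  by \<open>Gam\<close> are instances of the same identity.\<close>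

lemma nab2_cyclic:
  assumes "u \<in> U" "\<And>u x y z. u \<in> U \<Longrightarrow> nab B u x y z + nab B u y z x + nab B u z x y = 0"
  shows "nab2 B u w x y z + nab2 B u w y z x + nab2 B u w z x y = 0"
proof -
  have "((\<lambda>u. nab B u x y z + nab B u y z x + nab B u z x y) has_derivative
    (\<lambda>w. dd (\<lambda>u. nab B u x y z) u w + dd (\<lambda>u. nab B u y z x) u w + dd (\<lambda>u. nab B u z x y) u w)) (at u)"
    by (intro has_derivative_add has_frechet_derivative nab_diff assms(1))
  then have "((\<lambda>u. 0) has_derivative
    (\<lambda>w. dd (\<lambda>u. nab B u x y z) u w + dd (\<lambda>u. nab B u y z x) u w + dd (\<lambda>u. nab B u z x y) u w)) (at u)"
    by (rule has_derivative_transform_within_open[OF _ open_U assms(1)]) (rule assms(2))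
  from dd_eq[OF this, of w] show ?thesis
    using assms(2)[OF assms(1), of "Gam u w x" y z] assms(2)[OF assms(1), of x "Gam u w y" z]
      assms(2)[OF assms(1), of x y "Gam u w z"] by (simp add: nab2_def)
qed

lemma nab2_skew:
  assumes "u \<in> U" "\<And>u x y. u \<in> U \<Longrightarrow> B u y x = - B u x y"
  shows "nab2 B u w x z y = - nab2 B u w x y z"
proof -
  have skew: "nab B u x z y = - nab B u x y z" if "u \<in> U" for u x y z
    using nab_skew[OF that assms(2) B] .
  have "dd (\<lambda>u. nab B u x z y) u w = dd (\<lambda>u. - nab B u x y z) u w"
    by (rule dd_cong[OF open_U assms(1) skew nab_diff[OF assms(1)]])
  then have "dd (\<lambda>u. nab B u x z y) u w = - dd (\<lambda>u. nab B u x y z) u w"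
    unfolding dd_minus[OF nab_diff[OF assms(1)]] .
  then show ?thesis
    using skew[OF assms(1), of "Gam u w x" y z] skew[OF assms(1), of x "Gam u w y" z]
      skew[OF assms(1), of x y "Gam u w z"]
    unfolding nab2_def by linarith
qed

end

end

section \<open>Almost Kaehler structures in a chart\<close>

text \<open>Second derivatives are taken of \<open>G\<close> and of the Kaehler form, hence
  \<open>C2_form\<close> for these two, while \<open>J\<close> itself is differentiated once.
  \<open>Om_closed\<close> is the invariant formula on constant fields, where the bracket terms drop
  out.\<close>

locale kaehler_chart = connection_chart U Gam
  for U :: "'e::euclidean_space set" and Gam :: "'e \<Rightarrow> 'e \<Rightarrow> 'e \<Rightarrow> 'e" +
  fixes G :: "'e \<Rightarrow> 'e \<Rightarrow> 'e \<Rightarrow> real" and J :: "'e \<Rightarrow> 'e \<Rightarrow> 'e"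
  assumes G_form: "C2_form G"
    and Om_form: "C2_form (\<lambda>u x y. G u (J u x) y)"
    and G_sym: "u \<in> U \<Longrightarrow> G u x y = G u y x"
    and G_pos: "u \<in> U \<Longrightarrow> x \<noteq> 0 \<Longrightarrow> G u x x > 0"
    and J_linear: "u \<in> U \<Longrightarrow> linear (J u)"
    and J_diff: "u \<in> U \<Longrightarrow> (\<lambda>u. J u x) differentiable at u"
    and J_J: "u \<in> U \<Longrightarrow> J u (J u x) = - x"
    and J_isometry: "u \<in> U \<Longrightarrow> G u (J u x) (J u y) = G u x y"
    and G_parallel: "u \<in> U \<Longrightarrow> nab G u x y z = 0"
    and Om_closed: "u \<in> U \<Longrightarrow> dd (\<lambda>u. G u (J u y) z) u x - dd (\<lambda>u. G u (J u x) z) u y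
      + dd (\<lambda>u. G u (J u x) y) u z = 0"
begin

definition Om :: "'e \<Rightarrow> 'e \<Rightarrow> 'e \<Rightarrow> real" where
  "Om u x y = G u (J u x) y"

definition N :: "'e \<Rightarrow> 'e \<Rightarrow> 'e \<Rightarrow> 'e" where
  "N u x y = dd (\<lambda>u. J u y) u x + Gam u x (J u y) - J u (Gam u x y)"

text \<open>The hypothesis at one point, made homogeneous in \<open>x\<close> so that neither lines
  nor unit vectors appear.\<close>

definition complex_line_condition :: "'e \<Rightarrow> bool" where
  "complex_line_condition u \<longleftrightarrow>
     (\<forall>x y. Riem u y x x + Riem u y (J u x) (J u x) = 0) \<or> (\<forall>x z. Riem u x (J u x) z = 0)"

lemma Om_C2: "C2_form Om"
  using Om_form unfolding C2_form_def Om_def .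

lemmas G_linear1 = C2_form_linear1[OF G_form]
lemmas G_linear2 = C2_form_linear2[OF G_form]

lemma G_J:
  assumes "u \<in> U"
  shows "G u (J u x) y = - G u x (J u y)"
  using J_isometry[OF assms, of x "J u y"] J_J[OF assms]
  by (simp add: linear_neg[OF G_linear2[OF assms]])

lemma Om_skew:
  assumes "u \<in> U"
  shows "Om u y x = - Om u x y"
  using G_J[OF assms, of y x] G_sym[OF assms, of y "J u x"] unfolding Om_def by simp

lemma nab_Om_skew: "u \<in> U \<Longrightarrow> nab Om u x z y = - nab Om u x y z"
  using nab_skew Om_skew Om_C2 by blast

text \<open>Since \<open>G\<close> is parallel, the covariant derivative of \<open>G (J y) z\<close>
  falls on \<open>J\<close> alone.\<close>

lemma nab_Om:
  assumes "u \<in> U"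
  shows "nab Om u x y z = G u (N u x y) z"
proof -
  have "((\<lambda>u. G u (J u y) z) has_derivative
      (\<lambda>v. dd (\<lambda>v. G v (J u y) z) u v + G u (dd (\<lambda>v. J v y) u v) z)) (at u)"
    by (rule has_derivative_linear_family[where L = "\<lambda>v a. G v a z", OF open_U assms G_linear1
          C2_form_diff[OF G_form assms] has_frechet_derivative[OF J_diff[OF assms]]])
  from dd_eq[OF this] have "dd (\<lambda>u. Om u y z) u x =
      dd (\<lambda>v. G v (J u y) z) u x + G u (dd (\<lambda>v. J v y) u x) z"
    by (simp add: Om_def)
  moreover have "dd (\<lambda>v. G v (J u y) z) u x = G u (Gam u x (J u y)) z + G u (J u y) (Gam u x z)"
    using G_parallel[OF assms, of x "J u y" z] by (simp add: nab_def)
  ultimately show ?thesis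
    by (simp add: nab_def N_def Om_def linear_add[OF G_linear1[OF assms]]
        linear_diff[OF G_linear1[OF assms]])
qed

text \<open>For a torsion-free connection the exterior derivative is the cyclic sum of covariant
  derivatives: the \<open>Gam\<close> terms cancel in pairs, as \<open>Gam\<close> is symmetric and
  \<open>Om\<close> skew.\<close>

lemma nab_Om_cyclic:
  assumes "u \<in> U"
  shows "nab Om u x y z + nab Om u y z x + nab Om u z x y = 0"
proof -
  have skew: "dd (\<lambda>u. Om u z x) u y = - dd (\<lambda>u. Om u x z) u y"
  proof -
    have "dd (\<lambda>u. Om u z x) u y = dd (\<lambda>u. - Om u x z) u y"
      by (rule dd_cong[OF open_U assms Om_skew C2_form_diff[OF Om_C2 assms]])
    then show ?thesis
      unfolding dd_minus[OF C2_form_diff[OF Om_C2 assms]] .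
  qed
  have "dd (\<lambda>u. Om u y z) u x + dd (\<lambda>u. Om u z x) u y + dd (\<lambda>u. Om u x y) u z = 0"
    using Om_closed[OF assms, of y z x] unfolding Om_def[symmetric] skew by linarith
  then show ?thesis
    using Om_skew[OF assms, of "Gam u x y" z] Om_skew[OF assms, of "Gam u y z" x]
      Om_skew[OF assms, of "Gam u z x" y]
    unfolding nab_def Gam_sym[OF assms, of y x] Gam_sym[OF assms, of x z]
      Gam_sym[OF assms, of z y] by linarith
qed

lemma N_J:
  assumes "u \<in> U"
  shows "N u x (J u y) = - J u (N u x y)"
proof -
  have "((\<lambda>v. J v (J v y)) has_derivative
      (\<lambda>w. dd (\<lambda>v. J v (J u y)) u w + J u (dd (\<lambda>v. J v y) u w))) (at u)"
    by (rule has_derivative_linear_family[OF open_U assms J_linear J_diff[OF assms]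
          has_frechet_derivative[OF J_diff[OF assms]]])
  then have "((\<lambda>v. - y) has_derivative
      (\<lambda>w. dd (\<lambda>v. J v (J u y)) u w + J u (dd (\<lambda>v. J v y) u w))) (at u)"
    by (rule has_derivative_transform_within_open[OF _ open_U assms]) (rule J_J)
  from dd_eq[OF this, of x] have "dd (\<lambda>v. J v (J u y)) u x = - J u (dd (\<lambda>v. J v y) u x)"
    by (simp add: eq_neg_iff_add_eq_0)
  then show ?thesis
    by (simp add: N_def linear_add[OF J_linear[OF assms]] linear_diff[OF J_linear[OF assms]]
        J_J[OF assms] linear_neg[OF Gam_linear2[OF assms]])
qed

lemma N_skew:
  assumes "u \<in> U"
  shows "G u (N u x y) z = - G u y (N u x z)"
  using nab_Om_skew[OF assms, of x y z] nab_Om[OF assms] G_sym[OF assms, of y] by simp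

text \<open>By \<open>N_J\<close> the form \<nabla>\<Omega> changes sign under \<open>J\<close> in
  its last two slots. Differentiating this relation, each derivative falling on \<open>J\<close>
  contributes a factor \<open>N\<close>, which yields the quadratic right-hand side.\<close>

lemma nab2_Om_J:
  assumes "u \<in> U"
  shows "nab2 Om u w x (J u y) (J u z) + nab2 Om u w x y z =
    - G u (N u x (N u w y)) (J u z) - G u (N u x (J u y)) (N u w z)"
proof -
  have bil: "bilinear (\<lambda>y z. nab Om v x y z)" if "v \<in> U" for v
    using nab_linear2[OF Om_C2 that] nab_linear3[OF Om_C2 that] by (simp add: bilinear_def)
  have JJ: "nab Om v a (J v b) (J v c) = - nab Om v a b c" if "v \<in> U" for v a b c
    by (simp add: nab_Om that N_J J_isometry linear_neg[OF G_linear1[OF that]])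
  let ?D = "\<lambda>y. dd (\<lambda>v. J v y) u"
  have "((\<lambda>v. nab Om v x (J v y) (J v z)) has_derivative
      (\<lambda>w. dd (\<lambda>v. nab Om v x (J u y) (J u z)) u w + nab Om u x (J u y) (?D z w)
        + nab Om u x (?D y w) (J u z))) (at u)"
    by (rule has_derivative_bilinear_family[where B = "\<lambda>v y z. nab Om v x y z", OF open_U assms bil
          nab_diff[OF Om_C2 assms] has_frechet_derivative[OF J_diff[OF assms]]
          has_frechet_derivative[OF J_diff[OF assms]]])
  then have "((\<lambda>v. - nab Om v x y z) has_derivative
      (\<lambda>w. dd (\<lambda>v. nab Om v x (J u y) (J u z)) u w + nab Om u x (J u y) (?D z w)
        + nab Om u x (?D y w) (J u z))) (at u)"
    by (rule has_derivative_transform_within_open[OF _ open_U assms]) (rule JJ)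
  from dd_eq[OF this, of w] have "- dd (\<lambda>v. nab Om v x y z) u w =
      dd (\<lambda>v. nab Om v x (J u y) (J u z)) u w + nab Om u x (J u y) (?D z w)
        + nab Om u x (?D y w) (J u z)"
    unfolding dd_minus[OF nab_diff[OF Om_C2 assms]] .
  moreover have "?D y w = N u w y - Gam u w (J u y) + J u (Gam u w y)" for y
    by (simp add: N_def)
  ultimately show ?thesis
    using JJ[OF assms] nab_Om[OF assms, symmetric]
    by (simp add: nab2_def bilinear_ladd[OF bil[OF assms]] bilinear_lsub[OF bil[OF assms]]
        bilinear_radd[OF bil[OF assms]] bilinear_rsub[OF bil[OF assms]])
qed

text \<open>Since \<open>G\<close> is parallel, its Ricci identity says that the curvature operators are skew.\<close>

lemma algebraic_curvature_Riem:
  assumes "u \<in> U"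
  shows "algebraic_curvature (\<lambda>x y z w. G u (Riem u x y z) w) (J u)"
proof
  fix x x' y z w
  note lin = G_linear1[OF assms]
  show "G u (Riem u (x + x') y z) w = G u (Riem u x y z) w + G u (Riem u x' y z) w"
    by (simp add: linear_add[OF Riem_linear1[OF assms]] linear_add[OF lin])
  show "G u (Riem u y x z) w = - G u (Riem u x y z) w"
    by (subst Riem_skew) (rule linear_neg[OF lin])
  show "G u (Riem u x y w) z = - G u (Riem u x y z) w"
    using ricci_identity[OF G_form assms, of x y z w] nab2_eq_0[OF G_form assms G_parallel]
      G_sym[OF assms, of z] by simp
  show "G u (Riem u x y z) w + G u (Riem u y z x) w + G u (Riem u z x y) w = 0"
    using Riem_bianchi[OF assms, of x y z] linear_0[OF lin]
    by (simp add: linear_add[OF lin, symmetric])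
  show "J u (J u x) = - x"
    by (rule J_J[OF assms])
  show "J u (x + y) = J u x + J u y"
    by (rule linear_add[OF J_linear[OF assms]])
qed

lemma Riem_complex_linear:
  assumes "u \<in> U" "complex_line_condition u"
  shows "G u (Riem u (J u x) y z) w = G u (Riem u x (J u y) z) w"
    and "G u (Riem u x y (J u z)) w = G u (Riem u (J u x) y z) w"
proof -
  note curv = algebraic_curvature_Riem[OF assms(1)]
  note lin = G_linear1[OF assms(1)]
  have "(\<forall>x y w. G u (Riem u y x x) w + G u (Riem u y (J u x) (J u x)) w = 0) \<or>
      (\<forall>x z w. G u (Riem u x (J u x) z) w = 0)"
    using assms(2) linear_0[OF lin]
    by (auto simp: complex_line_condition_def linear_add[OF lin, symmetric])
  then show "G u (Riem u (J u x) y z) w = G u (Riem u x (J u y) z) w"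
    and "G u (Riem u x y (J u z)) w = G u (Riem u (J u x) y z) w"
    using algebraic_curvature.complex_linear_if_flat_lines[OF curv]
      algebraic_curvature.complex_linear_if_jacobi_flat_lines[OF curv] by blast+
qed

text \<open>A curvature operator commuting with \<open>J\<close> would make the two terms cancel.
  Here complex linearity moves \<open>J\<close> into the first slot of both, and they add up
  instead.\<close>

lemma curvature_action_Om:
  assumes "u \<in> U" "complex_line_condition u"
  shows "- Om u (Riem u w x y) z - Om u y (Riem u w x z) = 2 * G u (Riem u (J u w) x y) z"
proof -
  note curv = algebraic_curvature_Riem[OF assms(1)]
  show ?thesis
    using G_J[OF assms(1), of "Riem u w x y" z] G_sym[OF assms(1), of "J u y" "Riem u w x z"]
      algebraic_curvature.R_skew34[OF curv, of w x "J u y" z]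
      algebraic_curvature.R_skew34[OF curv, of w x "J u z" y]
      algebraic_curvature.R_skew34[OF curv, of "J u w" x y z]
      Riem_complex_linear(2)[OF assms, of w x y z] Riem_complex_linear(2)[OF assms, of w x z y]
    by (simp add: Om_def)
qed

theorem N_eq_0:
  assumes "u \<in> U" "complex_line_condition u"
  shows "N u x y = 0"
proof -
  note curv = algebraic_curvature_Riem[OF assms(1)]
  note lin = G_linear1[OF assms(1)]
  note cl = Riem_complex_linear[OF assms]
  let ?K = "\<lambda>w x y z. - Om u (Riem u w x y) z - Om u y (Riem u w x z)"
  have "second_derivative_kaehler_form (G u) (J u) (N u) (nab2 Om u) ?K"
  proof
    fix w x x' y z
    show "G u x y = G u y x" "G u (x + x') y = G u x y + G u x' y" "J u (J u x) = - x"
      "G u (J u x) (J u y) = G u x y" "G u (N u x y) z = - G u y (N u x z)"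
      "N u x (J u y) = - J u (N u x y)"
      by (fact G_sym[OF assms(1)] linear_add[OF lin] J_J[OF assms(1)] J_isometry[OF assms(1)]
          N_skew[OF assms(1)] N_J[OF assms(1)])+
    show "x \<noteq> 0 \<Longrightarrow> G u x x > 0"
      by (rule G_pos[OF assms(1)])
    show "G u (N u x y) z + G u (N u y z) x + G u (N u z x) y = 0"
      using nab_Om_cyclic[OF assms(1), of x y z] by (simp add: nab_Om[OF assms(1)])
    show "nab2 Om u w x z y = - nab2 Om u w x y z"
      by (rule nab2_skew[OF Om_C2 assms(1) Om_skew])
    show "nab2 Om u w x y z + nab2 Om u w y z x + nab2 Om u w z x y = 0"
      by (rule nab2_cyclic[OF Om_C2 assms(1) nab_Om_cyclic])
    show "nab2 Om u w x (J u y) (J u z) + nab2 Om u w x y z =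
        - G u (N u x (N u w y)) (J u z) - G u (N u x (J u y)) (N u w z)"
      by (rule nab2_Om_J[OF assms(1)])
    show "nab2 Om u w x y z - nab2 Om u x w y z = ?K w x y z"
      by (rule ricci_identity[OF Om_C2 assms(1)])
    \<comment> \<open>Complex linearity reduces both sides to
      \<open>2 * G u (Riem u x w w) x\<close>.\<close>
    show "?K x w x (J u w) = ?K x (J u w) x w"
      unfolding curvature_action_Om[OF assms]
      using cl(2)[of "J u x" w w x] cl(1)[of "J u x" w x w] algebraic_curvature.R_skew34[OF curv, of "J u x" w "J u w" x]
        algebraic_curvature.R_skew34[OF curv, of x w w x] J_J[OF assms(1)] algebraic_curvature.R_neg[OF curv, of x w] by simp
  qed (fact nab2_neg[OF Om_C2 assms(1)])+
  then show ?thesis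
    by (rule second_derivative_kaehler_form.N_eq_0)
qed

theorem Riem_eq_0:
  assumes "u \<in> U" "complex_line_condition u"
    and parallel: "\<And>u x y z. u \<in> U \<Longrightarrow> nab Om u x y z = 0"
  shows "Riem u x y z = 0"
proof (rule ccontr)
  assume "Riem u x y z \<noteq> 0"
  note curv = algebraic_curvature_Riem[OF assms(1)]
  have "G u (Riem u (J u x) y z) w = 0" for x w
    using ricci_identity[OF Om_C2 assms(1), of x y z w] nab2_eq_0[OF Om_C2 assms(1) parallel]
      curvature_action_Om[OF assms(1,2), of x y z w] by simp
  from this[of "J u x"] have "G u (Riem u x y z) w = 0" for w
    by (simp add: J_J[OF assms(1)] algebraic_curvature.R_neg[OF curv])
  then show False
    using G_pos[OF assms(1) \<open>Riem u x y z \<noteq> 0\<close>] by simp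
qed

end

section \<open>Change of charts\<close>

locale smooth_manifold_locale =
  fixes M :: "('a, 'e::euclidean_space) mfd"
  assumes smooth_manifold: "smooth_manifold M"
begin

lemma chart_openin: "c \<in> atlas M \<Longrightarrow> openin (mtop M) (fst c)"
  using smooth_manifold by (simp add: smooth_manifold_def is_chart_def)

lemma chart_homeomorphic:
  "c \<in> atlas M \<Longrightarrow> homeomorphic_map (subtopology (mtop M) (fst c)) (top_of_set (snd c ` fst c)) (snd c)"
  using smooth_manifold by (simp add: smooth_manifold_def is_chart_def)

lemma chart_subset: "c \<in> atlas M \<Longrightarrow> fst c \<subseteq> points M"
  by (intro openin_subset chart_openin)

lemma chart_image_open:
  assumes "c \<in> atlas M" "openin (mtop M) W"
  shows "open (snd c ` (fst c \<inter> W))"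
proof -
  have "open (snd c ` fst c)"
    using smooth_manifold assms(1) by (simp add: smooth_manifold_def is_chart_def)
  moreover have "openin (top_of_set (snd c ` fst c)) (snd c ` (fst c \<inter> W))"
    using homeomorphic_map_openness[OF chart_homeomorphic[OF assms(1)], of "fst c \<inter> W"]
      chart_subset[OF assms(1)] openin_subtopology_Int2[OF assms(2), of "fst c"] by auto
  ultimately show ?thesis
    using openin_open_trans by blast
qed

lemma chart_inv_eq:
  assumes "c \<in> atlas M" "q \<in> fst c"
  shows "chart_inv c (snd c q) = q"
proof (rule inv_into_f_f)
  have "topspace (subtopology (mtop M) (fst c)) = fst c"
    using chart_subset[OF assms(1)] by auto
  then show "inj_on (snd c) (fst c)"
    using homeomorphic_imp_injective_map[OF chart_homeomorphic[OF assms(1)]] by simp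
qed fact

lemma chart_at:
  assumes "p \<in> points M"
  shows "chart_at M p \<in> atlas M" "p \<in> fst (chart_at M p)"
proof -
  have "\<exists>c. c \<in> atlas M \<and> p \<in> fst c"
    using assms smooth_manifold unfolding smooth_manifold_def by blast
  then have "chart_at M p \<in> atlas M \<and> p \<in> fst (chart_at M p)"
    unfolding chart_at_def by (rule someI_ex)
  then show "chart_at M p \<in> atlas M" "p \<in> fst (chart_at M p)"
    by auto
qed

lemma transition_smooth:
  "c \<in> atlas M \<Longrightarrow> d \<in> atlas M \<Longrightarrow> Cinf_on (snd d \<circ> chart_inv c) (snd c ` (fst c \<inter> fst d))"
  using smooth_manifold by (simp add: smooth_manifold_def)

lemma transition_has_derivative:
  assumes "c \<in> atlas M" "d \<in> atlas M" "q \<in> fst c" "q \<in> fst d"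
  shows "((snd d \<circ> chart_inv c) has_derivative coord_change c d q) (at (snd c q))"
  unfolding coord_change_def
  by (intro has_frechet_derivative Cinf_on_differentiable[OF transition_smooth[OF assms(1,2)]])
    (use assms in auto)

lemma coord_change_linear:
  assumes "c \<in> atlas M" "d \<in> atlas M" "q \<in> fst c" "q \<in> fst d"
  shows "linear (coord_change c d q)"
  using transition_has_derivative[OF assms] has_derivative_linear by blast

lemma has_derivative_change_chart:
  fixes f :: "'a \<Rightarrow> 'b::real_normed_vector"
  assumes "c \<in> atlas M" "d \<in> atlas M" "q \<in> fst c" "q \<in> fst d"
    and f: "(f \<circ> chart_inv c) differentiable at (snd c q)"
  shows "((f \<circ> chart_inv d) has_derivative
    (\<lambda>v. dd (f \<circ> chart_inv c) (snd c q) (coord_change d c q v))) (at (snd d q))"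
proof -
  let ?h = "snd c \<circ> chart_inv d"
  have "?h (snd d q) = snd c q"
    using assms by (simp add: chart_inv_eq)
  then have "((\<lambda>u. (f \<circ> chart_inv c) (?h u)) has_derivative
      (\<lambda>v. dd (f \<circ> chart_inv c) (snd c q) (coord_change d c q v))) (at (snd d q))"
    using has_derivative_compose[OF transition_has_derivative[OF assms(2,1,4,3)],
        of "f \<circ> chart_inv c"] has_frechet_derivative[OF f] by simp
  then show ?thesis
    by (rule has_derivative_transform_within_open[OF _ chart_image_open[OF assms(2) chart_openin[OF assms(1)]]])
      (use assms in \<open>auto simp: chart_inv_eq\<close>)
qed

text \<open>The cocycle rule is the change-of-chart formula applied to the coordinate map
  \<open>snd e\<close> as the function.\<close>

lemma coord_change_comp:
  assumes "c \<in> atlas M" "d \<in> atlas M" "e \<in> atlas M" "q \<in> fst c" "q \<in> fst d" "q \<in> fst e"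
  shows "coord_change c e q (coord_change d c q v) = coord_change d e q v"
proof -
  have "(snd e \<circ> chart_inv c) differentiable at (snd c q)"
    using transition_has_derivative[OF assms(1,3,4,6)] by (auto simp: differentiable_def)
  from dd_eq[OF has_derivative_change_chart[OF assms(1,2,4,5) this]] show ?thesis
    by (simp add: coord_change_def)
qed

lemma coord_change_self:
  assumes "c \<in> atlas M" "q \<in> fst c"
  shows "coord_change c c q v = v"
proof -
  have "((\<lambda>u. u) has_derivative (\<lambda>v. v)) (at (snd c q))"
    by (rule has_derivative_ident)
  then have "((snd c \<circ> chart_inv c) has_derivative (\<lambda>v. v)) (at (snd c q))"
    by (rule has_derivative_transform_within_open[OF _ chart_image_open[OF assms(1) chart_openin[OF assms(1)]]])
      (use assms in \<open>auto simp: chart_inv_eq\<close>)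
  then show ?thesis
    unfolding coord_change_def by (rule dd_eq)
qed

lemma chart_diff_linear:
  assumes "c \<in> atlas M" "q \<in> fst c"
  shows "linear (chart_diff M c q)"
  unfolding chart_diff_def
  using coord_change_linear assms chart_at chart_subset by blast

lemma dir_deriv_chart:
  assumes "c \<in> atlas M" "q \<in> fst c" "(f \<circ> chart_inv c) differentiable at (snd c q)"
  shows "dir_deriv M q v f = dd (f \<circ> chart_inv c) (snd c q) (chart_diff M c q v)"
proof -
  have "q \<in> points M"
    using assms chart_subset by blast
  then show ?thesis
    unfolding dir_deriv_def chart_diff_def
    using dd_eq[OF has_derivative_change_chart[OF assms(1) _ assms(2) _ assms(3)]] chart_at by blast
qed

lemma smooth_field_subset:
  "smooth_field M W X \<Longrightarrow> W' \<subseteq> W \<Longrightarrow> smooth_field M W' X"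
  unfolding smooth_field_def by (meson Cinf_on_subset Int_mono image_mono order_refl)

lemma smooth_field_differentiable:
  assumes "smooth_field M W X" "c \<in> atlas M" "q \<in> fst c" "q \<in> W"
  shows "field_in_chart M c X differentiable at (snd c q)"
  using assms Cinf_on_differentiable[of "field_in_chart M c X" "snd c ` (fst c \<inter> W)" "snd c q"]
  unfolding smooth_field_def by blast

end

section \<open>Coordinate fields\<close>

locale preferred_chart = smooth_manifold_locale M
  for M :: "('a, 'e::euclidean_space) mfd" +
  fixes p :: 'a
  assumes p_in: "p \<in> points M"
begin

abbreviation c :: "('a, 'e) chart" where
  "c \<equiv> chart_at M p"

abbreviation E :: "'e \<Rightarrow> 'a \<Rightarrow> 'e" where
  "E \<equiv> coord_field M p"

abbreviation U :: "'e set" where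
  "U \<equiv> snd c ` fst c"

lemmas c_atlas = chart_at(1)[OF p_in]
lemmas p_in_c = chart_at(2)[OF p_in]
lemmas c_openin = chart_openin[OF c_atlas]
lemmas c_inv = chart_inv_eq[OF c_atlas]

lemma in_points: "q \<in> fst c \<Longrightarrow> q \<in> points M"
  using chart_subset[OF c_atlas] by blast

lemma open_U: "open U"
  using chart_image_open[OF c_atlas c_openin] by simp

lemma coord_field_linear: "q \<in> fst c \<Longrightarrow> linear (\<lambda>v. E v q)"
  unfolding coord_field_def
  using coord_change_linear[OF c_atlas chart_at(1) _ chart_at(2)] in_points by blast

lemma chart_diff_coord_field:
  assumes "d \<in> atlas M" "q \<in> fst c" "q \<in> fst d"
  shows "chart_diff M d q (E v q) = coord_change c d q v"
  unfolding chart_diff_def coord_field_def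
  using coord_change_comp[OF chart_at(1)[of q] c_atlas assms(1)] chart_at(2) in_points assms by blast

lemma chart_diff_c_coord_field: "q \<in> fst c \<Longrightarrow> chart_diff M c q (E v q) = v"
  using chart_diff_coord_field[OF c_atlas] coord_change_self[OF c_atlas] by simp

lemma coord_field_chart_diff:
  assumes "q \<in> fst c"
  shows "E (chart_diff M c q w) q = w"
  unfolding chart_diff_def coord_field_def
  using coord_change_comp[OF c_atlas chart_at(1)[of q] chart_at(1)[of q]]
    coord_change_self[OF chart_at(1)[of q]] chart_at(2)[of q] in_points[OF assms] assms by simp

lemma coord_field_at: "E v p = v"
  unfolding coord_field_def by (rule coord_change_self[OF c_atlas p_in_c])

lemma chart_diff_at: "chart_diff M c p v = v"
  unfolding chart_diff_def by (rule coord_change_self[OF c_atlas p_in_c])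

lemma coord_field_in_chart: "q \<in> fst c \<Longrightarrow> E (field_in_chart M c F (snd c q)) q = F q"
  unfolding field_in_chart_def by (simp add: c_inv coord_field_chart_diff)

lemma field_in_chart_at: "field_in_chart M c F (snd c p) = F p"
  unfolding field_in_chart_def by (simp add: c_inv p_in_c chart_diff_at)

text \<open>In a chart \<open>d\<close> the components of \<open>E v\<close> are the derivative of
  the transition map from \<open>c\<close> to \<open>d\<close> in the fixed direction
  \<open>v\<close>, read in the coordinates of \<open>d\<close>.\<close>

lemma smooth_coord_field: "smooth_field M (fst c) (E v)"
  unfolding smooth_field_def
proof
  fix d assume d: "d \<in> atlas M"
  let ?S = "snd d ` (fst d \<inter> fst c)" and ?T = "snd c ` (fst c \<inter> fst d)"
  have S: "open ?S" and T: "open ?T"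
    using chart_image_open chart_openin c_atlas d by auto
  have "Cinf_on (\<lambda>u. dd (snd d \<circ> chart_inv c) ((snd c \<circ> chart_inv d) u) v) ?S"
  proof (rule Cinf_on_compose[where f = "\<lambda>u. dd (snd d \<circ> chart_inv c) u v", OF S T])
    show "Cinf_on (\<lambda>u. dd (snd d \<circ> chart_inv c) u v) ?T"
      by (rule Cinf_on_derivative[OF transition_smooth[OF c_atlas d]])
    show "Cinf_on (snd c \<circ> chart_inv d) ?S"
      by (rule transition_smooth[OF d c_atlas])
    show "(snd c \<circ> chart_inv d) ` ?S \<subseteq> ?T"
      by (auto simp: chart_inv_eq[OF d])
  qed
  then show "Cinf_on (field_in_chart M d (E v)) ?S"
    by (rule Cinf_on_cong[OF S])
      (auto simp: field_in_chart_def chart_inv_eq[OF d] chart_diff_coord_field[OF d] coord_change_def)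
qed

text \<open>The bracket at \<open>q\<close> is computed in the preferred chart of \<open>q\<close>,
  where coordinate fields of \<open>c\<close> are not constant. Their components are first
  derivatives of the transition map, so the bracket is a difference of mixed second
  derivatives.\<close>

lemma lie_bracket_coord_field:
  assumes "q \<in> fst c"
  shows "lie_bracket M (E x) (E y) q = 0"
proof -
  let ?e = "chart_at M q"
  have e: "?e \<in> atlas M" "q \<in> fst ?e"
    using chart_at in_points[OF assms] by blast+
  let ?\<phi> = "snd ?e \<circ> chart_inv c" and ?T = "snd c ` (fst c \<inter> fst ?e)"
  have T: "open ?T" "snd c q \<in> ?T"
    using chart_image_open[OF c_atlas chart_openin[OF e(1)]] assms e by auto
  have smooth: "Cinf_on ?\<phi> ?T"
    by (rule transition_smooth[OF c_atlas e(1)])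
  have D: "dd (field_in_chart M ?e (E y)) (snd ?e q) (E x q) = dd (\<lambda>u. dd ?\<phi> u y) (snd c q) x" for x y
  proof -
    let ?f = "\<lambda>q. coord_change c ?e q y"
    have diff: "(\<lambda>u. dd ?\<phi> u y) differentiable at (snd c q)"
      by (rule Cinf_on_differentiable[OF Cinf_on_derivative[OF smooth] T(2)])
    have eq: "dd ?\<phi> u y = (?f \<circ> chart_inv c) u" if "u \<in> ?T" for u
      using that by (auto simp: coord_change_def c_inv)
    have "(?f \<circ> chart_inv c) differentiable at (snd c q)"
      by (rule differentiable_transform_within_open[OF diff T eq])
    from has_derivative_change_chart[OF c_atlas e(1) assms e(2) this]
    have "((?f \<circ> chart_inv ?e) has_derivative
        (\<lambda>v. dd (?f \<circ> chart_inv c) (snd c q) (coord_change ?e c q v))) (at (snd ?e q))" .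
    then have "(field_in_chart M ?e (E y) has_derivative
        (\<lambda>v. dd (?f \<circ> chart_inv c) (snd c q) (coord_change ?e c q v))) (at (snd ?e q))"
    proof (rule has_derivative_transform_within_open[OF _ chart_image_open[OF e(1) c_openin]])
      show "snd ?e q \<in> snd ?e ` (fst ?e \<inter> fst c)"
        using e assms by auto
      show "(?f \<circ> chart_inv ?e) u = field_in_chart M ?e (E y) u" if "u \<in> snd ?e ` (fst ?e \<inter> fst c)" for u
        using that by (auto simp: field_in_chart_def chart_inv_eq[OF e(1)] chart_diff_coord_field[OF e(1)])
    qed
    from dd_eq[OF this, of "E x q"]
    have "dd (field_in_chart M ?e (E y)) (snd ?e q) (E x q) =
        dd (?f \<circ> chart_inv c) (snd c q) (chart_diff M c q (E x q))"
      unfolding chart_diff_def .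
    then show ?thesis
      unfolding chart_diff_c_coord_field[OF assms]
      using dd_cong[OF T, of "\<lambda>u. dd ?\<phi> u y" "?f \<circ> chart_inv c" x, OF eq diff]
      by (simp add: o_def)
  qed
  have "Ck_on 2 ?\<phi> ?T"
    using smooth unfolding Cinf_on_def by blast
  then show ?thesis
    unfolding lie_bracket_def Let_def D
    using second_derivative_symmetric[OF T, of ?\<phi> x y] by simp
qed

lemma dir_deriv_coord_field:
  assumes "smooth_fun M (fst c) f" "q \<in> fst c"
  shows "dir_deriv M q (E v q) f = dd (f \<circ> chart_inv c) (snd c q) v"
proof -
  have "Cinf_on (f \<circ> chart_inv c) U"
    using assms(1) c_atlas unfolding smooth_fun_def by auto
  then have "(f \<circ> chart_inv c) differentiable at (snd c q)"
    by (rule Cinf_on_differentiable) (use assms(2) in blast)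
  then show ?thesis
    using dir_deriv_chart[OF c_atlas assms(2)] chart_diff_c_coord_field[OF assms(2)] by simp
qed

lemma dir_deriv_at: "dir_deriv M p v f = dd (f \<circ> chart_inv c) (snd c p) v"
  by (simp add: dir_deriv_def)

end

section \<open>The Levi-Civita connection in coordinates\<close>

locale almost_kaehler_locale =
  fixes M :: "('a, 'e::euclidean_space) mfd"
    and g :: "'a \<Rightarrow> 'e \<Rightarrow> 'e \<Rightarrow> real"
    and J :: "'a \<Rightarrow> 'e \<Rightarrow> 'e"
    and nabla :: "'a \<Rightarrow> 'e \<Rightarrow> ('a \<Rightarrow> 'e) \<Rightarrow> 'e"
  assumes almost_kaehler: "almost_kaehler_manifold M g J"
    and levi_civita: "levi_civita_connection M g nabla"
begin

sublocale smooth_manifold_locale M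
  using almost_kaehler
  by unfold_locales (simp add: almost_kaehler_manifold_def almost_hermitian_manifold_def)

lemma metric: "riemannian_metric M g"
  using almost_kaehler by (simp add: almost_kaehler_manifold_def almost_hermitian_manifold_def)

lemma acs: "almost_complex_structure M J"
  using almost_kaehler by (simp add: almost_kaehler_manifold_def almost_hermitian_manifold_def)

lemma g_bilinear: "q \<in> points M \<Longrightarrow> bilinear (g q)"
  and g_sym: "q \<in> points M \<Longrightarrow> g q x y = g q y x"
  and g_pos: "q \<in> points M \<Longrightarrow> x \<noteq> 0 \<Longrightarrow> g q x x > 0"
  using metric unfolding riemannian_metric_def by blast+

lemma g_smooth:
  "openin (mtop M) W \<Longrightarrow> smooth_field M W X \<Longrightarrow> smooth_field M W Y \<Longrightarrow>
    smooth_fun M W (\<lambda>p. g p (X p) (Y p))"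
  using metric unfolding riemannian_metric_def by blast

lemma J_linear: "q \<in> points M \<Longrightarrow> linear (J q)"
  and J_J: "q \<in> points M \<Longrightarrow> J q (J q x) = - x"
  and J_smooth: "openin (mtop M) W \<Longrightarrow> smooth_field M W X \<Longrightarrow> smooth_field M W (\<lambda>p. J p (X p))"
  using acs unfolding almost_complex_structure_def by blast+

lemma J_isometry: "q \<in> points M \<Longrightarrow> g q (J q x) (J q y) = g q x y"
  using almost_kaehler unfolding almost_kaehler_manifold_def almost_hermitian_manifold_def by blast

lemma Om_closed:
  "openin (mtop M) W \<Longrightarrow> smooth_field M W X \<Longrightarrow> smooth_field M W Y \<Longrightarrow> smooth_field M W Z \<Longrightarrow>
    p \<in> W \<Longrightarrow> ext_deriv2 M (kaehler_form g J) X Y Z p = 0"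
  using almost_kaehler unfolding almost_kaehler_manifold_def closed_2form_def by blast

lemmas affine = levi_civita[unfolded levi_civita_connection_def, THEN conjunct1,
    unfolded affine_connection_def, THEN spec, THEN spec, THEN mp, THEN mp]

lemma nabla_linear:
  assumes "openin (mtop M) W" "smooth_field M W Y" "p \<in> W"
  shows "linear (\<lambda>v. nabla p v Y)"
  using affine[OF assms(1,2), THEN conjunct1] assms(3) by (rule bspec)

lemma nabla_smooth:
  assumes "openin (mtop M) W" "smooth_field M W Y" "smooth_field M W X"
  shows "smooth_field M W (\<lambda>p. nabla p (X p) Y)"
  using affine[OF assms(1,2), THEN conjunct2, THEN conjunct2, THEN conjunct2, THEN conjunct2] assms(3)
  by simp

lemma nabla_torsion:
  "openin (mtop M) W \<Longrightarrow> smooth_field M W X \<Longrightarrow> smooth_field M W Y \<Longrightarrow> p \<in> W \<Longrightarrow>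
    nabla p (X p) Y - nabla p (Y p) X = lie_bracket M X Y p"
  using levi_civita[unfolded levi_civita_connection_def, THEN conjunct2, THEN conjunct1] by simp

lemma nabla_metric:
  "openin (mtop M) W \<Longrightarrow> smooth_field M W Y \<Longrightarrow> smooth_field M W Z \<Longrightarrow> p \<in> W \<Longrightarrow>
    dir_deriv M p v (\<lambda>q. g q (Y q) (Z q)) = g p (nabla p v Y) (Z p) + g p (Y p) (nabla p v Z)"
  using levi_civita[unfolded levi_civita_connection_def, THEN conjunct2, THEN conjunct2] by simp

end

locale almost_kaehler_chart = almost_kaehler_locale M g J nabla + preferred_chart M p
  for M :: "('a, 'e::euclidean_space) mfd" and g J nabla p
begin

section \<open>Components of the metric, the almost complex structure and the connection\<close>

definition cG :: "'e \<Rightarrow> 'e \<Rightarrow> 'e \<Rightarrow> real" where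
  "cG u x y = g (chart_inv c u) (E x (chart_inv c u)) (E y (chart_inv c u))"

definition cJ :: "'e \<Rightarrow> 'e \<Rightarrow> 'e" where
  "cJ u x = field_in_chart M c (\<lambda>q. J q (E x q)) u"

definition cGam :: "'e \<Rightarrow> 'e \<Rightarrow> 'e \<Rightarrow> 'e" where
  "cGam u x y = field_in_chart M c (\<lambda>q. nabla q (E x q) (E y)) u"

lemma cG: "q \<in> fst c \<Longrightarrow> cG (snd c q) x y = g q (E x q) (E y q)"
  by (simp add: cG_def c_inv)

lemma E_cJ: "q \<in> fst c \<Longrightarrow> E (cJ (snd c q) x) q = J q (E x q)"
  unfolding cJ_def by (rule coord_field_in_chart)

lemma E_cGam: "q \<in> fst c \<Longrightarrow> E (cGam (snd c q) x y) q = nabla q (E x q) (E y)"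
  unfolding cGam_def by (rule coord_field_in_chart)

lemma cJ: "q \<in> fst c \<Longrightarrow> cJ (snd c q) x = chart_diff M c q (J q (E x q))"
  by (simp add: cJ_def field_in_chart_def c_inv)

lemma cGam: "q \<in> fst c \<Longrightarrow> cGam (snd c q) x y = chart_diff M c q (nabla q (E x q) (E y))"
  by (simp add: cGam_def field_in_chart_def c_inv)

lemma E_inj: "q \<in> fst c \<Longrightarrow> E v q = E w q \<Longrightarrow> v = w"
  using chart_diff_c_coord_field by metis

lemma smooth_JE: "smooth_field M (fst c) (\<lambda>q. J q (E x q))"
  by (intro J_smooth c_openin smooth_coord_field)

lemma smooth_nablaE: "smooth_field M (fst c) (\<lambda>q. nabla q (E x q) (E y))"
  by (intro nabla_smooth c_openin smooth_coord_field)

lemma smooth_cG: "smooth_fun M (fst c) (\<lambda>q. g q (E x q) (E y q))"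
  by (intro g_smooth c_openin smooth_coord_field)

lemma smooth_Om: "smooth_fun M (fst c) (\<lambda>q. g q (J q (E x q)) (E y q))"
  by (intro g_smooth c_openin smooth_coord_field smooth_JE)

lemma Cinf_cG: "Cinf_on (\<lambda>u. cG u x y) U"
  using smooth_cG[of x y] c_atlas unfolding smooth_fun_def cG_def o_def by fastforce

lemma Cinf_Om: "Cinf_on (\<lambda>u. cG u (cJ u x) y) U"
proof (rule Cinf_on_cong[OF open_U])
  show "Cinf_on ((\<lambda>q. g q (J q (E x q)) (E y q)) \<circ> chart_inv c) U"
    using smooth_Om[of x y] c_atlas unfolding smooth_fun_def by fastforce
  show "((\<lambda>q. g q (J q (E x q)) (E y q)) \<circ> chart_inv c) u = cG u (cJ u x) y" if "u \<in> U" for u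
    using that by (auto simp: cG E_cJ c_inv)
qed

lemma cJ_diff: "u \<in> U \<Longrightarrow> (\<lambda>u. cJ u x) differentiable at u"
  unfolding cJ_def using smooth_field_differentiable[OF smooth_JE c_atlas] by blast

lemma cGam_diff: "u \<in> U \<Longrightarrow> (\<lambda>u. cGam u x y) differentiable at u"
  unfolding cGam_def using smooth_field_differentiable[OF smooth_nablaE c_atlas] by blast

lemma cG_bilinear:
  assumes "q \<in> fst c"
  shows "bilinear (cG (snd c q))"
proof -
  note lin = coord_field_linear[OF assms]
  have bil: "bilinear (g q)"
    using g_bilinear in_points assms by blast
  show ?thesis
    unfolding bilinear_def cG[OF assms]
    using linear_compose[OF lin, of "g q x" for x] linear_compose[OF lin, of "\<lambda>x. g q x y" for y] bil
    unfolding o_def bilinear_def by blast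
qed

lemma cGam_linear1:
  assumes "q \<in> fst c"
  shows "linear (\<lambda>x. cGam (snd c q) x y)"
  unfolding cGam[OF assms]
  using linear_compose[OF linear_compose[OF coord_field_linear[OF assms]
        nabla_linear[OF c_openin smooth_coord_field assms]] chart_diff_linear[OF c_atlas assms]]
  unfolding o_def .

lemma cJ_linear:
  assumes "q \<in> fst c"
  shows "linear (cJ (snd c q))"
  unfolding cJ[OF assms]
  using linear_compose[OF linear_compose[OF coord_field_linear[OF assms]
        J_linear[OF in_points[OF assms]]] chart_diff_linear[OF c_atlas assms]]
  unfolding o_def cJ[OF assms, abs_def] .

lemma cGam_sym:
  assumes "q \<in> fst c"
  shows "cGam (snd c q) x y = cGam (snd c q) y x"
  using nabla_torsion[OF c_openin smooth_coord_field smooth_coord_field assms, of x y]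
    lie_bracket_coord_field[OF assms, of x y]
  by (simp add: cGam[OF assms])

lemma dd_cG:
  assumes "q \<in> fst c"
  shows "dd (\<lambda>u. cG u y z) (snd c q) x = dir_deriv M q (E x q) (\<lambda>q. g q (E y q) (E z q))"
  unfolding dir_deriv_coord_field[OF smooth_cG assms] by (simp add: cG_def o_def)

lemma dd_Om:
  assumes "q \<in> fst c"
  shows "dd (\<lambda>u. cG u (cJ u y) z) (snd c q) x =
    dir_deriv M q (E x q) (\<lambda>q. g q (J q (E y q)) (E z q))"
  unfolding dir_deriv_coord_field[OF smooth_Om assms]
proof (rule dd_cong[OF open_U])
  show "snd c q \<in> U"
    using assms by blast
  then show "(\<lambda>u. cG u (cJ u y) z) differentiable at (snd c q)"
    by (rule Cinf_on_differentiable[OF Cinf_Om])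
  show "cG u (cJ u y) z = ((\<lambda>q. g q (J q (E y q)) (E z q)) \<circ> chart_inv c) u" if "u \<in> U" for u
    using that by (auto simp: cG E_cJ c_inv)
qed

sublocale connection_chart U cGam
proof (rule connection_chart.intro)
  show "open U"
    by (rule open_U)
  fix u x y assume u: "u \<in> U"
  then obtain q where q: "q \<in> fst c" "u = snd c q"
    by blast
  show "linear (\<lambda>x. cGam u x y)"
    unfolding q(2) by (rule cGam_linear1[OF q(1)])
  show "cGam u x y = cGam u y x"
    unfolding q(2) by (rule cGam_sym[OF q(1)])
  show "(\<lambda>u. cGam u x y) differentiable at u"
    by (rule cGam_diff[OF u])
qed

sublocale chart: kaehler_chart U cGam cG cJ
proof (intro kaehler_chart.intro kaehler_chart_axioms.intro)
  show "connection_chart U cGam"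
    by unfold_locales
  show "C2_form cG"
    using cG_bilinear Cinf_cG unfolding C2_form_def Cinf_on_def by blast
  show "C2_form (\<lambda>u x y. cG u (cJ u x) y)"
    unfolding C2_form_def
  proof (intro conjI ballI allI)
    fix u assume "u \<in> U"
    then obtain q where q: "q \<in> fst c" "u = snd c q"
      by blast
    have "linear (\<lambda>x. cG u (cJ u x) y)" for y
      using cG_bilinear[OF q(1)] linear_compose[OF cJ_linear[OF q(1)], of "\<lambda>x. cG u x y"]
      unfolding q(2) bilinear_def o_def by blast
    then show "bilinear (\<lambda>x y. cG u (cJ u x) y)"
      using cG_bilinear[OF q(1)] unfolding q(2) bilinear_def by blast
  next
    show "Ck_on 2 (\<lambda>u. cG u (cJ u x) y) U" for x y
      using Cinf_Om unfolding Cinf_on_def by blast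
  qed
  fix u x y z assume "u \<in> U"
  then obtain q where q: "q \<in> fst c" "u = snd c q"
    by blast
  have q': "q \<in> points M"
    by (rule in_points[OF q(1)])
  note lin = coord_field_linear[OF q(1)]
  show "cG u x y = cG u y x"
    by (simp add: q cG g_sym[OF q', of "E x q"])
  show "cG u x x > 0" if "x \<noteq> 0"
    using g_pos[OF q', of "E x q"] E_inj[OF q(1), of x 0] linear_0[OF lin] that by (auto simp: q cG)
  show "linear (cJ u)"
    using cJ_linear q by simp
  show "(\<lambda>u. cJ u x) differentiable at u"
    by (rule cJ_diff[OF \<open>u \<in> U\<close>])
  show "cJ u (cJ u x) = - x"
    by (rule E_inj[OF q(1)]) (simp add: q E_cJ J_J[OF q'] linear_neg[OF lin])
  show "cG u (cJ u x) (cJ u y) = cG u x y"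
    by (simp add: q cG E_cJ J_isometry[OF q'])
  show "nab cG u x y z = 0"
    using nabla_metric[OF c_openin smooth_coord_field smooth_coord_field q(1), of "E x q" y z]
    by (simp add: nab_def q dd_cG cG E_cGam)
  show "dd (\<lambda>u. cG u (cJ u y) z) u x - dd (\<lambda>u. cG u (cJ u x) z) u y
      + dd (\<lambda>u. cG u (cJ u x) y) u z = 0"
    using Om_closed[OF c_openin smooth_coord_field smooth_coord_field smooth_coord_field q(1), of x y z]
      bilinear_lzero[OF g_bilinear[OF q']] linear_0[OF J_linear[OF q']]
    by (simp add: q dd_Om ext_deriv2_def kaehler_form_def lie_bracket_coord_field[OF q(1)])
qed

lemma u0: "snd c p \<in> U"
  using p_in_c by blast

lemma cG_at: "cG (snd c p) x y = g p x y"
  by (simp add: cG[OF p_in_c] coord_field_at)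

lemma cJ_at: "cJ (snd c p) x = J p x"
  by (simp add: cJ[OF p_in_c] coord_field_at chart_diff_at)

lemma cGam_at: "cGam (snd c p) x y = nabla p x (E y)"
  by (simp add: cGam[OF p_in_c] coord_field_at chart_diff_at)

text \<open>Metric compatibility against the coordinate fields determines \<open>nabla\<close>, so no expansion of
  \<open>F\<close> in a frame is needed.\<close>

lemma nabla_in_chart:
  assumes W: "openin (mtop M) W" "p \<in> W" and F: "smooth_field M W F"
  shows "nabla p v F = dd (field_in_chart M c F) (snd c p) v + cGam (snd c p) v (F p)"
proof -
  let ?u = "snd c p" and ?F = "field_in_chart M c F" and ?W = "W \<inter> fst c"
  have W': "openin (mtop M) ?W" "p \<in> ?W" "smooth_field M ?W F"
    using W F c_openin p_in_c smooth_field_subset by blast+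
  have EW: "smooth_field M ?W (E z)" for z
    using smooth_coord_field smooth_field_subset by blast
  have D: "(?F has_derivative dd ?F ?u) (at ?u)"
    by (rule has_frechet_derivative[OF smooth_field_differentiable[OF F c_atlas p_in_c W(2)]])
  have "cG ?u (nabla p v F) z = cG ?u (dd ?F ?u v + cGam ?u v (F p)) z" for z
  proof -
    have "((\<lambda>u. cG u (?F u) z) has_derivative
        (\<lambda>v. dd (\<lambda>u. cG u (?F ?u) z) ?u v + cG ?u (dd ?F ?u v) z)) (at ?u)"
      by (rule has_derivative_linear_family[where L = "\<lambda>u a. cG u a z", OF open_U u0 chart.G_linear1
            C2_form_diff[OF chart.G_form u0] D])
    then have "(((\<lambda>q. g q (F q) (E z q)) \<circ> chart_inv c) has_derivative
        (\<lambda>v. dd (\<lambda>u. cG u (?F ?u) z) ?u v + cG ?u (dd ?F ?u v) z)) (at ?u)"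
      by (rule has_derivative_transform_within_open[OF _ open_U u0])
        (auto simp: cG coord_field_in_chart c_inv)
    from dd_eq[OF this, of v] have "g p (nabla p v F) z + g p (F p) (nabla p v (E z)) =
        dd (\<lambda>u. cG u (F p) z) ?u v + cG ?u (dd ?F ?u v) z"
      using nabla_metric[OF W'(1,3) EW W'(2), of v z]
      by (simp add: dir_deriv_at coord_field_at field_in_chart_at)
    moreover have "dd (\<lambda>u. cG u (F p) z) ?u v = cG ?u (cGam ?u v (F p)) z + cG ?u (F p) (cGam ?u v z)"
      using chart.G_parallel[OF u0, of v "F p" z] by (simp add: nab_def)
    ultimately show ?thesis
      by (simp add: cG_at cGam_at linear_add[OF chart.G_linear1[OF u0], unfolded cG_at])
  qed
  then have "cG ?u (nabla p v F - (dd ?F ?u v + cGam ?u v (F p))) z = 0" for z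
    by (simp add: linear_diff[OF chart.G_linear1[OF u0]])
  then show ?thesis
    using chart.G_pos[OF u0] by (metis eq_iff_diff_eq_0 less_irrefl)
qed

text \<open>The inner field has components \<open>cGam u y z\<close>, so
  \<open>nabla_in_chart\<close> evaluates the outer derivative. The formula is for the centre
  \<open>p\<close>, since \<open>curvature_op\<close> uses the coordinate fields belonging to its
  own base point.\<close>

lemma curvature_op_eq_Riem: "curvature_op M nabla p x y z = Riem (snd c p) x y z"
proof -
  have "nabla p (E x p) (\<lambda>q. nabla q (E y q) (E z)) =
      dd (\<lambda>u. cGam u y z) (snd c p) x + cGam (snd c p) x (cGam (snd c p) y z)" for x y
    using nabla_in_chart[OF c_openin p_in_c smooth_nablaE, of x y z]
    unfolding cGam_def[of _ y z, abs_def, symmetric] by (simp add: coord_field_at cGam_at)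
  then show ?thesis
    using linear_0[OF nabla_linear[OF c_openin smooth_coord_field p_in_c]]
    by (simp add: curvature_op_def field_curvature_def Riem_def lie_bracket_coord_field[OF p_in_c])
qed

text \<open>\<open>chart.N_eq_0\<close> applies only at the base point of a preferred chart, whereas \<open>chart.Riem_eq_0\<close>
  needs \<open>\<nabla>\<Omega> = 0\<close> on a whole chart. The following chart-free form of \<open>\<nabla>J = 0\<close> bridges the gap.\<close>

lemma nabla_J:
  assumes W: "openin (mtop M) W" "p \<in> W" and F: "smooth_field M W F"
    and cond: "chart.complex_line_condition (snd c p)"
  shows "nabla p v (\<lambda>q. J q (F q)) = J p (nabla p v F)"
proof -
  let ?u = "snd c p" and ?F = "field_in_chart M c F"
  have D: "(?F has_derivative dd ?F ?u) (at ?u)"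
    by (rule has_frechet_derivative[OF smooth_field_differentiable[OF F c_atlas p_in_c W(2)]])
  have "((\<lambda>u. cJ u (?F u)) has_derivative
      (\<lambda>v. dd (\<lambda>u. cJ u (?F ?u)) ?u v + cJ ?u (dd ?F ?u v))) (at ?u)"
    by (rule has_derivative_linear_family[OF open_U u0 chart.J_linear cJ_diff[OF u0] D])
  then have "(field_in_chart M c (\<lambda>q. J q (F q)) has_derivative
      (\<lambda>v. dd (\<lambda>u. cJ u (?F ?u)) ?u v + cJ ?u (dd ?F ?u v))) (at ?u)"
    by (rule has_derivative_transform_within_open[OF _ open_U u0])
      (auto simp: cJ coord_field_in_chart c_inv field_in_chart_def[of M c "\<lambda>q. J q (F q)"])
  from dd_eq[OF this, of v] have "nabla p v (\<lambda>q. J q (F q)) =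
      dd (\<lambda>u. cJ u (F p)) ?u v + cJ ?u (dd ?F ?u v) + cGam ?u v (J p (F p))"
    using nabla_in_chart[OF W J_smooth[OF W(1) F], of v] by (simp add: field_in_chart_at)
  moreover have "dd (\<lambda>u. cJ u (F p)) ?u v + cGam ?u v (J p (F p)) = J p (cGam ?u v (F p))"
    using chart.N_eq_0[OF u0 cond, of v "F p"] by (simp add: chart.N_def cJ_at)
  ultimately show ?thesis
    unfolding nabla_in_chart[OF W F]
    by (simp add: linear_add[OF J_linear[OF p_in]] cJ_at algebra_simps)
qed

end

section \<open>Complex lines and flatness\<close>

context almost_kaehler_chart
begin

text \<open>\<open>J\<close> has no real eigenvector: \<open>x = k *\<^sub>R J p x\<close> would
  give \<open>x = - (k * k) *\<^sub>R x\<close>. Hence the span has dimension two.\<close>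

lemma complex_line_span:
  assumes "x \<noteq> 0"
  shows "(p, span {x, J p x}) \<in> complex_lines M J"
proof -
  note lin = J_linear[OF p_in] and JJ = J_J[OF p_in]
  have notin: "x \<notin> span {J p x}"
  proof
    assume "x \<in> span {J p x}"
    then obtain k where k: "x = k *\<^sub>R J p x"
      by (auto simp: span_singleton)
    then have "J p x = k *\<^sub>R J p (J p x)"
      using linear_scale[OF lin, of k "J p x"] by simp
    then have "x = - (k * k) *\<^sub>R x"
      using k JJ by simp
    then have "(1 + k * k) *\<^sub>R x = 0"
      using eq_neg_iff_add_eq_0[of x "(k * k) *\<^sub>R x"] by (simp add: scaleR_add_left)
    then show False
      using assms by (simp add: add_nonneg_eq_0_iff)
  qed
  have "J p x \<noteq> 0"
    using JJ[of x] linear_0[OF lin] assms by auto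
  then have "independent {x, J p x}" "x \<noteq> J p x"
    using notin span_base[of "J p x" "{J p x}"] by (auto simp: independent_insert)
  then have "dim (span {x, J p x}) = 2"
    by (simp add: dim_span dim_eq_card_independent)
  moreover have "J p ` span {x, J p x} = span {x, J p x}"
  proof -
    have "span {J p x, - x} = span {x, J p x}"
      using span_neg[OF span_base[of x "{x, J p x}"]] span_neg[OF span_base[of "- x" "{J p x, - x}"]]
      by (auto simp: span_eq intro: span_base)
    then show ?thesis
      by (simp add: span_linear_image[OF lin, symmetric] JJ)
  qed
  ultimately show ?thesis
    using p_in by (simp add: complex_lines_def)
qed

text \<open>The unit vector is an arbitrary choice in the line. That \<open>a * a + b * b\<close> is
  nonzero allows \<open>x\<close> to be recovered from it.\<close>

lemma unit_vector_in_complex_line: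
  assumes "x \<noteq> 0"
  obtains a b where "unit_vector_in g p (span {x, J p x}) = a *\<^sub>R x + b *\<^sub>R J p x"
    "a * a + b * b \<noteq> 0"
proof -
  let ?\<pi> = "span {x, J p x}" and ?s = "1 / sqrt (g p x x)"
  note bil = g_bilinear[OF p_in]
  have pos: "g p x x > 0"
    by (rule g_pos[OF p_in assms])
  have "?s *\<^sub>R x \<in> ?\<pi> \<and> g p (?s *\<^sub>R x) (?s *\<^sub>R x) = 1"
    using pos by (simp add: span_base span_scale bilinear_lmul[OF bil] bilinear_rmul[OF bil])
  then have y: "unit_vector_in g p ?\<pi> \<in> ?\<pi> \<and> g p (unit_vector_in g p ?\<pi>) (unit_vector_in g p ?\<pi>) = 1"
    unfolding unit_vector_in_def by (rule someI)
  then obtain a b where ab: "unit_vector_in g p ?\<pi> = a *\<^sub>R x + b *\<^sub>R J p x"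
    by (auto simp: span_insert span_singleton algebra_simps)
  moreover have "a * a + b * b \<noteq> 0"
    using ab y bilinear_lzero[OF bil] by (auto simp: sum_squares_eq_zero_iff)
  ultimately show thesis
    using that by blast
qed

lemma complex_line_condition:
  assumes "(\<forall>(p, \<pi>) \<in> complex_lines M J. \<forall>y. line_jacobi M g J nabla p \<pi> y = 0) \<or>
         (\<forall>(p, \<pi>) \<in> complex_lines M J. \<forall>z. line_curvature M g J nabla p \<pi> z = 0)"
  shows "chart.complex_line_condition (snd c p)"
proof -
  let ?R = "Riem (snd c p)"
  note lin = J_linear[OF p_in] and JJ = J_J[OF p_in]
  note R_lin = Riem_linear1[OF u0] Riem_linear2[OF u0] Riem_linear3[OF u0]
  note expand = linear_add[OF R_lin(1)] linear_add[OF R_lin(2)] linear_add[OF R_lin(3)]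
    linear_diff[OF R_lin(1)] linear_diff[OF R_lin(2)] linear_diff[OF R_lin(3)]
    linear_scale[OF R_lin(1)] linear_scale[OF R_lin(2)] linear_scale[OF R_lin(3)]
  \<comment> \<open>Division by the complex number \<open>a + b i\<close>, with \<open>J p\<close>
    in the role of \<open>i\<close> and the denominator cleared.\<close>
  have unit: "\<exists>a b. a * a + b * b \<noteq> 0 \<and>
      (a * a + b * b) *\<^sub>R x = a *\<^sub>R y - b *\<^sub>R J p y \<and>
      (a * a + b * b) *\<^sub>R J p x = a *\<^sub>R J p y + b *\<^sub>R y"
    if x: "x \<noteq> 0" and y: "y = unit_vector_in g p (span {x, J p x})" for x y
  proof -
    obtain a b where ab: "y = a *\<^sub>R x + b *\<^sub>R J p x" "a * a + b * b \<noteq> 0"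
      using unit_vector_in_complex_line[OF x] y by metis
    have Jy: "J p y = a *\<^sub>R J p x - b *\<^sub>R x"
      by (simp add: ab(1) linear_add[OF lin] linear_scale[OF lin] JJ)
    show ?thesis
    proof (intro exI conjI)
      show "a * a + b * b \<noteq> 0"
        by (rule ab(2))
      show "(a * a + b * b) *\<^sub>R x = a *\<^sub>R y - b *\<^sub>R J p y"
        unfolding Jy unfolding ab(1) by (simp add: algebra_simps)
      show "(a * a + b * b) *\<^sub>R J p x = a *\<^sub>R J p y + b *\<^sub>R y"
        unfolding Jy unfolding ab(1) by (simp add: algebra_simps)
    qed
  qed
  from assms show ?thesis
  proof
    assume jacobi: "\<forall>(p, \<pi>) \<in> complex_lines M J. \<forall>y. line_jacobi M g J nabla p \<pi> y = 0"
    have "?R y x x + ?R y (J p x) (J p x) = 0" for x y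
    proof (cases "x = 0")
      case True
      then show ?thesis
        by (simp add: linear_0[OF lin] linear_0[OF R_lin(3)])
    next
      case False
      define v where "v = unit_vector_in g p (span {x, J p x})"
      obtain a b where ab: "a * a + b * b \<noteq> 0" "(a * a + b * b) *\<^sub>R x = a *\<^sub>R v - b *\<^sub>R J p v"
        "(a * a + b * b) *\<^sub>R J p x = a *\<^sub>R J p v + b *\<^sub>R v"
        using unit[OF False v_def] by blast
      let ?s = "a * a + b * b"
      have v: "?R y v v + ?R y (J p v) (J p v) = 0"
        using jacobi complex_line_span[OF False]
        by (fastforce simp: line_jacobi_def Let_def jacobi_op_def curvature_op_eq_Riem v_def)
      have "(?s * ?s) *\<^sub>R (?R y x x + ?R y (J p x) (J p x)) =
          ?R y (?s *\<^sub>R x) (?s *\<^sub>R x) + ?R y (?s *\<^sub>R J p x) (?s *\<^sub>R J p x)"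
        unfolding linear_scale[OF R_lin(2)] linear_scale[OF R_lin(3)] by (simp add: scaleR_add_right)
      \<comment> \<open>The mixed terms with coefficient \<open>a * b\<close> cancel between the two
        summands.\<close>
      also have "\<dots> = ?s *\<^sub>R (?R y v v + ?R y (J p v) (J p v))"
        unfolding ab(2,3) expand by (simp add: algebra_simps)
      finally show ?thesis
        using ab(1) v by auto
    qed
    then show ?thesis
      by (simp add: chart.complex_line_condition_def cJ_at)
  next
    assume curv: "\<forall>(p, \<pi>) \<in> complex_lines M J. \<forall>z. line_curvature M g J nabla p \<pi> z = 0"
    have "?R x (J p x) z = 0" for x z
    proof (cases "x = 0")
      case True
      then show ?thesis
        by (simp add: linear_0[OF R_lin(1)])
    next
      case False
      define v where "v = unit_vector_in g p (span {x, J p x})"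
      obtain a b where ab: "a * a + b * b \<noteq> 0" "(a * a + b * b) *\<^sub>R x = a *\<^sub>R v - b *\<^sub>R J p v"
        "(a * a + b * b) *\<^sub>R J p x = a *\<^sub>R J p v + b *\<^sub>R v"
        using unit[OF False v_def] by blast
      let ?s = "a * a + b * b"
      have v: "?R v (J p v) z = 0"
        using curv complex_line_span[OF False]
        by (fastforce simp: line_curvature_def Let_def curvature_op_eq_Riem v_def)
      have diag: "?R v v z = 0" for v
        by (simp add: Riem_def)
      have "(?s * ?s) *\<^sub>R ?R x (J p x) z = ?R (?s *\<^sub>R x) (?s *\<^sub>R J p x) z"
        unfolding linear_scale[OF R_lin(1)] linear_scale[OF R_lin(2)] by simp
      \<comment> \<open>An alternating expression in a complex line scales with the determinant of
        the change of basis, which is \<open>?s\<close>.\<close>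
      also have "\<dots> = ?s *\<^sub>R ?R v (J p v) z"
        unfolding ab(2,3) expand Riem_skew[of _ v "J p v"] diag by (simp add: algebra_simps)
      finally show ?thesis
        using ab(1) v by auto
    qed
    then show ?thesis
      by (simp add: chart.complex_line_condition_def cJ_at)
  qed
qed

lemma curvature_op_eq_0:
  assumes cond: "chart.complex_line_condition (snd c p)"
    and parallel: "\<And>W q F v. \<lbrakk>openin (mtop M) W; q \<in> W; smooth_field M W F\<rbrakk> \<Longrightarrow>
      nabla q v (\<lambda>q. J q (F q)) = J q (nabla q v F)"
  shows "curvature_op M nabla p x y z = 0"
  unfolding curvature_op_eq_Riem
proof (rule chart.Riem_eq_0[OF u0 cond])
  fix u x y z assume "u \<in> U"
  then obtain q where q: "q \<in> fst c" "u = snd c q"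
    by blast
  \<comment> \<open>Metric compatibility differentiates the product of \<open>J (E y)\<close> and
    \<open>E z\<close>; once \<open>parallel\<close> pulls \<open>J\<close> out, what is left equals
    the \<open>Gam\<close> corrections in \<open>nab\<close>.\<close>
  show "nab chart.Om u x y z = 0"
    using nabla_metric[OF c_openin smooth_JE smooth_coord_field q(1), of "E x q" y z]
      parallel[OF c_openin q(1) smooth_coord_field, of "E x q" y]
    by (simp add: q nab_def chart.Om_def dd_Om cG E_cJ E_cGam)
qed

end

theorem theorem1p3:
  fixes M :: "('a, 'e::euclidean_space) mfd"
    and g :: "'a \<Rightarrow> 'e \<Rightarrow> 'e \<Rightarrow> real"
    and J :: "'a \<Rightarrow> 'e \<Rightarrow> 'e"
    and nabla :: "'a \<Rightarrow> 'e \<Rightarrow> ('a \<Rightarrow> 'e) \<Rightarrow> 'e"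
  assumes "almost_kaehler_manifold M g J"
    and "levi_civita_connection M g nabla"
    and "(\<forall>(p, \<pi>) \<in> complex_lines M J. \<forall>y. line_jacobi M g J nabla p \<pi> y = 0) \<or>
         (\<forall>(p, \<pi>) \<in> complex_lines M J. \<forall>z. line_curvature M g J nabla p \<pi> z = 0)"
  shows "flat M nabla"
proof -
  have ak: "almost_kaehler_locale M g J nabla"
    using assms(1,2) by (rule almost_kaehler_locale.intro)
  have mf: "smooth_manifold_locale M"
    using assms(1) by (simp add: smooth_manifold_locale_def almost_kaehler_manifold_def
        almost_hermitian_manifold_def)
  have chart: "almost_kaehler_chart M g J nabla p" if "p \<in> points M" for p
    using ak mf that
    by (intro almost_kaehler_chart.intro preferred_chart.intro preferred_chart_axioms.intro)
  note cond = almost_kaehler_chart.complex_line_condition[OF chart assms(3)]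
  \<comment> \<open>Every point is treated at the centre of its own preferred chart, where the
    curvature condition is available.\<close>
  have parallel: "nabla q v (\<lambda>q. J q (F q)) = J q (nabla q v F)"
    if "openin (mtop M) W" "q \<in> W" "smooth_field M W F" for W q F v
  proof -
    have q: "q \<in> points M"
      using that(1,2) openin_subset by blast
    show ?thesis
      by (rule almost_kaehler_chart.nabla_J[OF chart[OF q] that cond[OF q]])
  qed
  show ?thesis
    unfolding flat_def
  proof (intro ballI allI)
    fix p x y z assume p: "p \<in> points M"
    show "curvature_op M nabla p x y z = 0"
      by (rule almost_kaehler_chart.curvature_op_eq_0[OF chart[OF p] cond[OF p] parallel])
  qed
qed

end
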